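(* Let $(V,\omega)$ be a finite-dimensional real symplectic vector space, $\xi$ the induced contact structure on $\mathbb{P}V$, and let $\Pi_\infty\in\mathbb{P}V^*$ be a fixed hyperplane, taken as the plane at infinity of an affine chart of $\mathbb{P}V$. Let $\Sigma\subset\mathbb{P}V$ be a table. Then the following are equivalent: 1. the midpoint reflection rule over $\Sigma$ in this affine chart generates a contact transformation of $(\mathbb{P}V,\xi)$; 2. the midpoint reflection rule over $\Sigma$ coincides with the outer contact billiard reflection rule over $\Sigma$; 3. $\Sigma$ is a generalized cone with vertex at the contact point $q_\infty\in\Pi_\infty$ of the plane at infinity (the point with $\Pi_\infty=\xi_{q_\infty}$).
   Context: $\mathbb{P}V$ is the space of lines through the origin in $V$; $W^\omega$ denotes the $\omega$-orthogonal complement of a subspace $W$. The contact structure is $\xi_q=q^\omega$; the contact point of a hyperplane $\Pi\subset V$ is $\Pi^\omega\in\mathbb{P}V$. A table is a regular hypersurface $\Sigma\subset\mathbb{P}V$; for $q\in\Sigma$ put $q'=(T_q\Sigma)^\omega$, with $T_q\Sigma$ the projective tangent hyperplane viewed as a hyperplane of $V$. When $q'\ne q$ the characteristic line at $q$ is the projective line through $q$ and $q'$. Outer contact billiard reflection rule over $\Sigma$: $Z,Z'$ on the characteristic line at $q\in\Sigma$ correspond if they are harmonic conjugates with respect to $q,q'$ (there are lifts with $\mathbf Z=\mathbf q+\mathbf q'$, $\mathbf Z'=\mathbf q-\mathbf q'$). Midpoint reflection rule over $\Sigma$ in the affine chart $\mathbb{P}V\setminus\Pi_\infty$: $Z,Z'$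 on the characteristic line at $q\in\Sigma$ correspond if $q$ is the affine midpoint of $Z$ and $Z'$ in the chart. A rule generates a contact transformation if the maps $Z\mapsto Z'$ it defines preserve $\xi$; here, as throughout, reflection rules are considered where they define local diffeomorphisms. A generalized cone with vertex $q_\infty$ is a hypersurface all of whose tangent hyperplanes pass through $q_\infty$ (a hypersurface ruled by lines through $q_\infty$).
   Formalization: Assumes the points of Σ over which the midpoint rule defines a local diffeomorphism are dense in the part of Σ in the chart; without this a hyperplane Σ not through q_∞ satisfies (1) vacuously but not (3). In (2) the rules are compared at base points in the chart. *)

theory Defs
  imports "HOL-Analysis.Analysis"
begin

section \<open>Smooth maps between open subsets of vector spaces\<close>

text \<open>The partial derivatives of a function on a finite-dimensional space are its directional
  derivatives, so on open sets this is the usual class of k times continuously differentiable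
  functions.\<close>

primrec Ck_on :: "nat \<Rightarrow> 'a set \<Rightarrow> ('a::euclidean_space \<Rightarrow> 'b::real_normed_vector) \<Rightarrow> bool" where
  "Ck_on 0 W f \<longleftrightarrow> continuous_on W f"
| "Ck_on (Suc k) W f \<longleftrightarrow>
     (\<forall>x\<in>W. f differentiable (at x)) \<and> (\<forall>v. Ck_on k W (\<lambda>x. frechet_derivative f (at x) v))"

definition smooth_on :: "'a set \<Rightarrow> ('a::euclidean_space \<Rightarrow> 'b::real_normed_vector) \<Rightarrow> bool" where
  "smooth_on W f \<longleftrightarrow> open W \<and> (\<forall>k. Ck_on k W f)"

section \<open>Symplectic vector spaces\<close>

text \<open>The vector space V is a type of class \<open>euclidean_space\<close>, i.e. an arbitrary nonzero
  finite-dimensional real vector space; its inner product is only used through the topology it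
  induces.  The symplectic form is an arbitrary one, unrelated to the inner product.\<close>

definition symplectic_form :: "('a::euclidean_space \<Rightarrow> 'a \<Rightarrow> real) \<Rightarrow> bool" where
  "symplectic_form \<omega> \<longleftrightarrow>
     bilinear \<omega> \<and> (\<forall>v. \<omega> v v = 0) \<and> (\<forall>v. (\<forall>w. \<omega> v w = 0) \<longrightarrow> v = 0)"

definition symp_orth :: "('a::euclidean_space \<Rightarrow> 'a \<Rightarrow> real) \<Rightarrow> 'a set \<Rightarrow> 'a set" where
  "symp_orth \<omega> W = {v. \<forall>w\<in>W. \<omega> v w = 0}"

section \<open>Projective space\<close>

text \<open>Points of projective space are lines through the origin, hyperplanes of projective space are
  linear hyperplanes of V.\<close>

definition proj_points :: "'a::euclidean_space set set" where
  "proj_points = {L. subspace L \<and> dim L = 1}"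

definition proj_hyperplane :: "'a::euclidean_space set \<Rightarrow> bool" where
  "proj_hyperplane H \<longleftrightarrow> subspace H \<and> dim H = DIM('a) - 1"

text \<open>All lifts of the points of a set of projective points, i.e. the cone over it without the
  origin (\<open>span {0}\<close> is not a projective point).\<close>

definition lifts :: "'a::euclidean_space set set \<Rightarrow> 'a set" where
  "lifts U = {v. span {v} \<in> U}"

text \<open>The quotient topology.\<close>

definition proj_topology :: "'a::euclidean_space set topology" where
  "proj_topology = topology (\<lambda>U. U \<subseteq> proj_points \<and> open (lifts U))"

lemma openin_proj_topology:
  "openin proj_topology U \<longleftrightarrow> U \<subseteq> proj_points \<and> open (lifts U)"
proof -
  have "lifts (S \<inter> T) = lifts S \<inter> lifts T" for S T :: "'a set set"
    by (auto simp: lifts_def)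
  moreover have "lifts (\<Union>K) = (\<Union>U\<in>K. lifts U)" for K :: "'a set set set"
    by (auto simp: lifts_def)
  ultimately have "istopology (\<lambda>U::'a set set. U \<subseteq> proj_points \<and> open (lifts U))"
    unfolding istopology_def by auto
  then show ?thesis
    by (simp add: proj_topology_def)
qed

text \<open>\<open>F\<close> is a smooth lift over the open set \<open>W\<close> of V of the map \<open>\<phi>\<close> between projective points.\<close>

definition smooth_lift ::
  "'a::euclidean_space set \<Rightarrow> ('a \<Rightarrow> 'a) \<Rightarrow> ('a set \<Rightarrow> 'a set) \<Rightarrow> bool" where
  "smooth_lift W F \<phi> \<longleftrightarrow> smooth_on W F \<and> (\<forall>x\<in>W. F x \<noteq> 0 \<and> \<phi> (span {x}) = span {F x})"

definition proj_smooth_on ::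
  "'a::euclidean_space set set \<Rightarrow> ('a set \<Rightarrow> 'a set) \<Rightarrow> bool" where
  "proj_smooth_on U \<phi> \<longleftrightarrow>
     (\<forall>v\<in>lifts U. \<exists>W F. v \<in> W \<and> W \<subseteq> lifts U \<and> smooth_lift W F \<phi>)"

text \<open>A diffeomorphism between two open subsets of projective space.\<close>

definition proj_diffeo_on ::
  "'a::euclidean_space set set \<Rightarrow> ('a set \<Rightarrow> 'a set) \<Rightarrow> bool" where
  "proj_diffeo_on U \<phi> \<longleftrightarrow>
     openin proj_topology U \<and> openin proj_topology (\<phi> ` U) \<and> inj_on \<phi> U \<and>
     proj_smooth_on U \<phi> \<and> proj_smooth_on (\<phi> ` U) (the_inv_into U \<phi>)"

section \<open>The contact structure\<close>

definition contact_hyperplane :: "('a::euclidean_space \<Rightarrow> 'a \<Rightarrow> real) \<Rightarrow> 'a set \<Rightarrow> 'a set" where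
  "contact_hyperplane \<omega> q = symp_orth \<omega> q"

definition contact_point :: "('a::euclidean_space \<Rightarrow> 'a \<Rightarrow> real) \<Rightarrow> 'a set \<Rightarrow> 'a set" where
  "contact_point \<omega> H = symp_orth \<omega> H"

text \<open>The tangent space of projective space at \<open>span {v}\<close> is the quotient of V by \<open>span {v}\<close>, and
  the differential of \<open>\<phi>\<close> at that point is induced by the derivative at \<open>v\<close> of any lift \<open>F\<close>.
  Hyperplanes of the tangent space are recorded by their preimages in V.  So the condition says
  that the differential maps exactly the vectors in the contact hyperplane at a point to vectors
  in the contact hyperplane at its image.\<close>

definition preserves_contact ::
  "('a::euclidean_space \<Rightarrow> 'a \<Rightarrow> real) \<Rightarrow> 'a set set \<Rightarrow> ('a set \<Rightarrow> 'a set) \<Rightarrow> bool" where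
  "preserves_contact \<omega> U \<phi> \<longleftrightarrow>
     (\<forall>W F. W \<subseteq> lifts U \<and> smooth_lift W F \<phi> \<longrightarrow>
        (\<forall>v\<in>W. \<forall>w. w \<in> contact_hyperplane \<omega> (span {v}) \<longleftrightarrow>
                     frechet_derivative F (at v) w \<in> contact_hyperplane \<omega> (\<phi> (span {v}))))"

section \<open>Tables\<close>

text \<open>A regular (smooth, embedded, not necessarily closed) hypersurface of projective space: the
  cone over it is locally the zero set of a smooth function without critical points.\<close>

definition table :: "'a::euclidean_space set set \<Rightarrow> bool" where
  "table S \<longleftrightarrow> S \<subseteq> proj_points \<and>
     (\<forall>v\<in>lifts S. \<exists>W (f :: 'a \<Rightarrow> real). v \<in> W \<and> smooth_on W f \<and>
        (\<forall>x\<in>W. frechet_derivative f (at x) \<noteq> (\<lambda>_. 0)) \<and>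
        W \<inter> lifts S = {x \<in> W. f x = 0})"

text \<open>The projective tangent hyperplane at \<open>q\<close>, as a hyperplane of V: the velocities of curves in
  the cone over \<open>S\<close> that start at a lift of \<open>q\<close>.\<close>

definition tangent_hyperplane :: "'a::euclidean_space set set \<Rightarrow> 'a set \<Rightarrow> 'a set" where
  "tangent_hyperplane S q =
     {w. \<exists>\<gamma> :: real \<Rightarrow> 'a. span {\<gamma> 0} = q \<and> (\<gamma> has_vector_derivative w) (at 0) \<and>
           (\<forall>\<^sub>F s in nhds 0. \<gamma> s \<in> lifts S)}"

definition dual_point ::
  "('a::euclidean_space \<Rightarrow> 'a \<Rightarrow> real) \<Rightarrow> 'a set set \<Rightarrow> 'a set \<Rightarrow> 'a set" where
  "dual_point \<omega> S q = contact_point \<omega> (tangent_hyperplane S q)"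

text \<open>A projective line is recorded as a linear plane in V; only meaningful if \<open>dual_point \<omega> S q\<close>
  differs from \<open>q\<close>.\<close>

definition characteristic_line ::
  "('a::euclidean_space \<Rightarrow> 'a \<Rightarrow> real) \<Rightarrow> 'a set set \<Rightarrow> 'a set \<Rightarrow> 'a set" where
  "characteristic_line \<omega> S q = span (q \<union> dual_point \<omega> S q)"

definition generalized_cone :: "'a::euclidean_space set set \<Rightarrow> 'a set \<Rightarrow> bool" where
  "generalized_cone S p \<longleftrightarrow> (\<forall>q\<in>S. p \<subseteq> tangent_hyperplane S q)"

section \<open>Reflection rules\<close>

text \<open>\<open>R q Z Z'\<close> means that \<open>Z\<close> and \<open>Z'\<close> correspond by reflection at the point \<open>q\<close> of the table.
  Both rules below relate distinct points only; this leaves out the trivial correspondence of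
  \<open>q\<close> (and in the outer rule of \<open>dual_point \<omega> S q\<close>) with itself.\<close>

type_synonym 'v reflection_rule = "'v set \<Rightarrow> 'v set \<Rightarrow> 'v set \<Rightarrow> bool"

definition outer_rule ::
  "('a::euclidean_space \<Rightarrow> 'a \<Rightarrow> real) \<Rightarrow> 'a set set \<Rightarrow> 'a reflection_rule" where
  "outer_rule \<omega> S q Z Z' \<longleftrightarrow> q \<in> S \<and> dual_point \<omega> S q \<noteq> q \<and>
     (\<exists>x x'. q = span {x} \<and> dual_point \<omega> S q = span {x'} \<and>
             Z = span {x + x'} \<and> Z' = span {x - x'})"

text \<open>The affine chart given by the complement of \<open>H\<close> is a translate of \<open>H\<close> not containing the
  origin: each point of the chart has exactly one lift in it.  The midpoint does not depend on
  the chosen translate.\<close>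

definition affine_midpoint :: "'a::euclidean_space set \<Rightarrow> 'a reflection_rule" where
  "affine_midpoint H q Z Z' \<longleftrightarrow>
     (\<exists>z z'. z \<notin> H \<and> z' - z \<in> H \<and> Z = span {z} \<and> Z' = span {z'} \<and> q = span {midpoint z z'})"

definition midpoint_rule ::
  "('a::euclidean_space \<Rightarrow> 'a \<Rightarrow> real) \<Rightarrow> 'a set \<Rightarrow> 'a set set \<Rightarrow> 'a reflection_rule" where
  "midpoint_rule \<omega> H S q Z Z' \<longleftrightarrow> q \<in> S \<and> dual_point \<omega> S q \<noteq> q \<and>
     Z \<subseteq> characteristic_line \<omega> S q \<and> Z' \<subseteq> characteristic_line \<omega> S q \<and>
     Z \<noteq> Z' \<and> affine_midpoint H q Z Z'"

text \<open>The local diffeomorphisms defined by a rule.\<close>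

definition rule_map ::
  "'a::euclidean_space reflection_rule \<Rightarrow> 'a set set \<Rightarrow> ('a set \<Rightarrow> 'a set) \<Rightarrow> bool" where
  "rule_map R U \<phi> \<longleftrightarrow> proj_diffeo_on U \<phi> \<and> (\<forall>Z\<in>U. \<exists>q. R q Z (\<phi> Z))"

definition generates_contact_transformation ::
  "('a::euclidean_space \<Rightarrow> 'a \<Rightarrow> real) \<Rightarrow> 'a reflection_rule \<Rightarrow> bool" where
  "generates_contact_transformation \<omega> R \<longleftrightarrow>
     (\<forall>U \<phi>. rule_map R U \<phi> \<longrightarrow> preserves_contact \<omega> U \<phi>)"

text \<open>The base points \<open>q\<close> over which the rule defines a local diffeomorphism somewhere on the
  characteristic line.\<close>

definition nondegenerate_points :: "'a::euclidean_space reflection_rule \<Rightarrow> 'a set set" where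
  "nondegenerate_points R = {q. \<exists>U \<phi> Z. rule_map R U \<phi> \<and> Z \<in> U \<and> R q Z (\<phi> Z)}"

text \<open>The part of \<open>S\<close> in the affine chart.\<close>

definition affine_part :: "'a::euclidean_space set \<Rightarrow> 'a set set \<Rightarrow> 'a set set" where
  "affine_part H S = {q \<in> S. \<not> q \<subseteq> H}"

text \<open>The standing assumption that the midpoint rule defines local diffeomorphisms, asked for
  generically on the table only.  Some such assumption is needed.  If \<open>S\<close> is a hyperplane, all
  its characteristic lines lie in \<open>S\<close>, so the rule never defines a local diffeomorphism; then no
  map is subject to the contact condition, but \<open>S\<close> is a cone with vertex \<open>contact_point \<omega> H\<close> only
  if it contains that point.\<close>

definition generically_nondegenerate ::
  "('a::euclidean_space \<Rightarrow> 'a \<Rightarrow> real) \<Rightarrow> 'a set \<Rightarrow> 'a set set \<Rightarrow> bool" where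
  "generically_nondegenerate \<omega> H S \<longleftrightarrow>
     affine_part H S \<subseteq> proj_topology closure_of nondegenerate_points (midpoint_rule \<omega> H S)"

text \<open>The midpoint rule lives in the chart, so the rules are compared at base points there.\<close>

definition rules_coincide ::
  "'a::euclidean_space set \<Rightarrow> 'a set set \<Rightarrow> 'a reflection_rule \<Rightarrow> 'a reflection_rule \<Rightarrow> bool" where
  "rules_coincide H S R R' \<longleftrightarrow> (\<forall>q\<in>affine_part H S. \<forall>Z Z'. R q Z Z' \<longleftrightarrow> R' q Z Z')"

end

theory Submission
  imports Defs
begin

text \<open>Let \<open>p\<close> span the contact point of the plane at infinity, so that \<open>H = ker (\<omega> p)\<close>.  At a base
  point \<open>q\<close> in the chart the two rules coincide iff \<open>q'\<close> is at infinity, i.e. iff \<open>p\<close> lies in the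
  tangent hyperplane at \<open>q\<close>.

  Let a local diffeomorphism be given by the midpoint rule.  Lifting its values to the level of
  \<open>z\<close> with respect to \<open>\<omega> p\<close>, it becomes \<open>x + y \<mapsto> x - y\<close>, where \<open>x\<close> is a smooth function of \<open>z = x + y\<close>
  with values in the cone over the table and \<open>y\<close> lies both at infinity and on the characteristic
  line.  As that line is isotropic, the contact form \<open>\<beta> = \<omega> z dz\<close> is pulled back to
  \<open>\<beta> - 4 \<gamma>\<close> with \<open>\<gamma> = \<omega> y dx\<close>.  If \<open>p\<close> is tangent at \<open>x\<close>, then \<open>y\<close> is a multiple of \<open>q'\<close> and
  \<open>\<gamma> = 0\<close>.  Conversely, if the contact structure is preserved and \<open>\<gamma> \<noteq> 0\<close>, then \<open>\<beta>\<close> is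
  proportional to \<open>\<gamma>\<close>.  But \<open>y\<close> is annihilated by \<open>dx\<close>, so contracting \<open>d\<beta> = 2 \<omega>\<close> with \<open>y\<close>
  shows that \<open>\<omega> y\<close> is proportional to \<open>\<omega> z\<close>, contradicting the nondegeneracy of \<open>\<omega>\<close>.  Hence
  \<open>\<gamma> = 0\<close>, and as \<open>dx\<close> maps onto the tangent hyperplane, \<open>y\<close> spans \<open>q'\<close>.\<close>

section \<open>Smooth functions\<close>

lemma smooth_on_has_derivative:
  assumes "smooth_on W f" and "x \<in> W"
  shows "(f has_derivative frechet_derivative f (at x)) (at x)"
proof -
  have "Ck_on (Suc 0) W f"
    using assms(1) unfolding smooth_on_def by blast
  then show ?thesis
    using assms(2) frechet_derivative_works by auto
qed

lemma smooth_on_differentiable_derivative: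
  assumes "smooth_on W f" and "x \<in> W"
  shows "(\<lambda>y. frechet_derivative f (at y) v) differentiable (at x)"
proof -
  have "Ck_on (Suc (Suc 0)) W f"
    using assms(1) unfolding smooth_on_def by blast
  then show ?thesis
    using assms(2) by auto
qed

section \<open>Symmetry of second derivatives\<close>

text \<open>The mean value theorem in the direction \<open>v\<close> turns the second difference
  into \<open>t\<close> times an increment of \<open>x \<mapsto> f' x v\<close>, and
  differentiability of this map at \<open>a\<close> makes the increment linear up to
  \<open>o(t)\<close>.\<close>

lemma second_difference_tendsto:
  fixes f :: "'a::real_normed_vector \<Rightarrow> real"
  assumes W: "open W" "a \<in> W"
    and f': "\<And>x. x \<in> W \<Longrightarrow> (f has_derivative f' x) (at x)"
    and D: "((\<lambda>x. f' x v) has_derivative D) (at a)"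
  shows "((\<lambda>t. (f (a + t *\<^sub>R u + t *\<^sub>R v) - f (a + t *\<^sub>R u) - f (a + t *\<^sub>R v) + f a) / t\<^sup>2)
            \<longlongrightarrow> D u) (at_right 0)"
proof (rule tendstoI)
  fix e :: real
  assume e: "e > 0"
  define N where "N = norm u + norm v + 1"
  have N: "N > 0" "norm u \<le> N" "norm v \<le> N"
    unfolding N_def by (simp_all add: add_nonneg_pos)
  \<comment> \<open>The linear approximation is used at two points, at a total cost of at most
    \<open>4 * \<epsilon> * N * t\<close>; the divisor \<open>6 * N\<close> keeps this strictly
    below \<open>e * t\<close>.\<close>
  define \<epsilon> where "\<epsilon> = e / (6 * N)"
  have \<epsilon>: "\<epsilon> > 0" using e N by (simp add: \<epsilon>_def)
  obtain d1 where d1: "d1 > 0"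
    and D1: "\<And>y. norm (y - a) < d1 \<Longrightarrow> norm (f' y v - f' a v - D (y - a)) \<le> \<epsilon> * norm (y - a)"
    using D \<epsilon> unfolding has_derivative_at_alt by metis
  obtain d2 where d2: "d2 > 0" "ball a d2 \<subseteq> W"
    using W open_contains_ball by blast
  define d where "d = min d1 d2 / (2 * N)"
  have d: "d > 0" using d1 d2 N by (simp add: d_def)
  have linD: "linear D" using D has_derivative_linear by blast
  have close: "dist ((f (a + t *\<^sub>R u + t *\<^sub>R v) - f (a + t *\<^sub>R u) - f (a + t *\<^sub>R v) + f a) / t\<^sup>2) (D u) < e"
    if t: "0 < t" "t < d" for t
  proof -
    have tN: "t * (2 * N) < min d1 d2"
      using t N d_def by (simp add: pos_less_divide_eq)
    have small: "norm (r *\<^sub>R u + s *\<^sub>R v) \<le> t * (2 * N)" if "0 \<le> r" "r \<le> t" "0 \<le> s" "s \<le> t" for r s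
    proof -
      have "norm (r *\<^sub>R u + s *\<^sub>R v) \<le> r * norm u + s * norm v"
        using norm_triangle_ineq[of "r *\<^sub>R u" "s *\<^sub>R v"] that by simp
      also have "\<dots> \<le> t * N + t * N"
        using that N t by (intro add_mono mult_mono) auto
      finally show ?thesis by (simp add: mult_ac)
    qed
    have inW: "a + (r *\<^sub>R u + s *\<^sub>R v) \<in> W" if "0 \<le> r" "r \<le> t" "0 \<le> s" "s \<le> t" for r s
      using small[OF that] tN
      by (intro subsetD[OF d2(2)]) (simp add: dist_commute[of a], simp add: dist_norm)
    \<comment> \<open>The summand \<open>0 *\<^sub>R u\<close> is kept so that both terms belong to
      one family, with \<open>r = t\<close> and \<open>r = 0\<close>.\<close>
    define g where "g = (\<lambda>s. f (a + (t *\<^sub>R u + s *\<^sub>R v)) - f (a + (0 *\<^sub>R u + s *\<^sub>R v)))"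
    have der: "((\<lambda>s. f (a + (r *\<^sub>R u + s *\<^sub>R v))) has_real_derivative f' (a + (r *\<^sub>R u + s *\<^sub>R v)) v) (at s)"
      if "0 \<le> r" "r \<le> t" "0 \<le> s" "s \<le> t" for r s
    proof -
      have line: "((\<lambda>s. a + (r *\<^sub>R u + s *\<^sub>R v)) has_derivative (\<lambda>h. h *\<^sub>R v)) (at s)"
        by (auto intro!: derivative_eq_intros)
      have "((\<lambda>s. f (a + (r *\<^sub>R u + s *\<^sub>R v))) has_derivative (\<lambda>h. f' (a + (r *\<^sub>R u + s *\<^sub>R v)) (h *\<^sub>R v))) (at s)"
        by (rule has_derivative_compose[OF line f'[OF inW[OF that]]])
      moreover have "f' (a + (r *\<^sub>R u + s *\<^sub>R v)) (h *\<^sub>R v) = h * f' (a + (r *\<^sub>R u + s *\<^sub>R v)) v" for h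
        using linear_cmul[OF has_derivative_linear[OF f'[OF inW[OF that]]]] by simp
      ultimately show ?thesis
        by (intro has_derivative_imp_has_field_derivative) auto
    qed
    have g': "(g has_real_derivative f' (a + (t *\<^sub>R u + s *\<^sub>R v)) v - f' (a + (0 *\<^sub>R u + s *\<^sub>R v)) v) (at s)"
      if "0 \<le> s" "s \<le> t" for s
      unfolding g_def using that t by (intro DERIV_diff der) auto
    obtain s where s: "0 < s" "s < t"
      and mvt: "g t - g 0 = (t - 0) * (f' (a + (t *\<^sub>R u + s *\<^sub>R v)) v - f' (a + (0 *\<^sub>R u + s *\<^sub>R v)) v)"
      using MVT2[OF t(1) g'] by auto
    let ?A = "f' (a + (t *\<^sub>R u + s *\<^sub>R v)) v - f' (a + (0 *\<^sub>R u + s *\<^sub>R v)) v"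
    have "\<bar>f' (a + (r *\<^sub>R u + s *\<^sub>R v)) v - f' a v - D (r *\<^sub>R u + s *\<^sub>R v)\<bar> \<le> \<epsilon> * (t * (2 * N))"
      if "0 \<le> r" "r \<le> t" for r
    proof -
      have "norm (r *\<^sub>R u + s *\<^sub>R v) \<le> t * (2 * N)" using small that s by auto
      moreover from this have "norm (f' (a + (r *\<^sub>R u + s *\<^sub>R v)) v - f' a v - D (r *\<^sub>R u + s *\<^sub>R v)) \<le> \<epsilon> * norm (r *\<^sub>R u + s *\<^sub>R v)"
        using D1[of "a + (r *\<^sub>R u + s *\<^sub>R v)"] tN by simp
      ultimately show ?thesis
        using \<epsilon> by (smt (verit) mult_left_mono real_norm_def)
    qed
    from this[of t] this[of 0]
    have "\<bar>?A - (D (t *\<^sub>R u + s *\<^sub>R v) - D (0 *\<^sub>R u + s *\<^sub>R v))\<bar> \<le> 2 * (\<epsilon> * (t * (2 * N)))"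
      using t by linarith
    moreover have "D (t *\<^sub>R u + s *\<^sub>R v) - D (0 *\<^sub>R u + s *\<^sub>R v) = t * D u"
      using linear_cmul[OF linD] linear_add[OF linD] by simp
    ultimately have "\<bar>?A - t * D u\<bar> \<le> 4 * \<epsilon> * N * t"
      by (simp add: mult_ac)
    also have "\<dots> < e * t"
      using e t N by (simp add: \<epsilon>_def)
    finally have A: "\<bar>?A - t * D u\<bar> < e * t" .
    have "(f (a + t *\<^sub>R u + t *\<^sub>R v) - f (a + t *\<^sub>R u) - f (a + t *\<^sub>R v) + f a) / t\<^sup>2 = (g t - g 0) / t\<^sup>2"
      by (simp add: g_def algebra_simps)
    also have "\<dots> = ?A / t"
      using mvt t by (simp add: power2_eq_square)
    finally have quot: "(f (a + t *\<^sub>R u + t *\<^sub>R v) - f (a + t *\<^sub>R u) - f (a + t *\<^sub>R v) + f a) / t\<^sup>2 = ?A / t" .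
    have "?A / t - D u = (?A - t * D u) / t"
      using t by (simp add: diff_divide_distrib)
    then have "\<bar>?A / t - D u\<bar> = \<bar>?A - t * D u\<bar> / t"
      using t by (simp only: abs_divide abs_of_pos)
    then have "\<bar>?A / t - D u\<bar> < e"
      using A t by (simp only: pos_divide_less_eq)
    then show ?thesis
      unfolding dist_real_def quot .
  qed
  then show "\<forall>\<^sub>F t in at_right 0. dist ((f (a + t *\<^sub>R u + t *\<^sub>R v) - f (a + t *\<^sub>R u) - f (a + t *\<^sub>R v) + f a) / t\<^sup>2) (D u) < e"
    unfolding eventually_at_right_field using d by blast
qed

text \<open>Exchanging \<open>u\<close> and \<open>v\<close> does not change the second difference
  quotient, and both second derivatives are its limit.\<close>

lemma second_derivative_symmetric:
  fixes f :: "'a::real_normed_vector \<Rightarrow> real"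
  assumes W: "open W" "a \<in> W"
    and f': "\<And>x. x \<in> W \<Longrightarrow> (f has_derivative f' x) (at x)"
    and Du: "((\<lambda>x. f' x u) has_derivative Du) (at a)"
    and Dv: "((\<lambda>x. f' x v) has_derivative Dv) (at a)"
  shows "Du v = Dv u"
proof -
  have swap: "a + t *\<^sub>R v + t *\<^sub>R u = a + t *\<^sub>R u + t *\<^sub>R v" for t
    by (simp add: add_ac)
  let ?q = "\<lambda>u v t. (f (a + t *\<^sub>R u + t *\<^sub>R v) - f (a + t *\<^sub>R u) - f (a + t *\<^sub>R v) + f a) / t\<^sup>2"
  have "?q v u = ?q u v"
  proof
    show "?q v u t = ?q u v t" for t
      unfolding swap by (rule arg_cong[where f = "\<lambda>x. x / t\<^sup>2"]) linarith
  qed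
  moreover have "(?q v u \<longlongrightarrow> Du v) (at_right 0)"
    by (rule second_difference_tendsto[where f' = f', OF W]) (use f' Du in auto)
  moreover have "(?q u v \<longlongrightarrow> Dv u) (at_right 0)"
    by (rule second_difference_tendsto[where f' = f', OF W]) (use f' Dv in auto)
  ultimately show ?thesis
    by (simp only:) (rule tendsto_unique[OF trivial_limit_at_right_real])
qed

section \<open>Tangent hyperplanes of tables\<close>

lemma span_singleton_eqD:
  assumes "span {x} = span {y :: 'a::real_vector}" and "y \<noteq> 0"
  obtains k where "k \<noteq> 0" "x = k *\<^sub>R y"
proof -
  have "x \<in> span {y}" using assms(1) span_base[of x "{x}"] by auto
  then obtain k where k: "x = k *\<^sub>R y" by (auto simp: span_singleton)
  have "k \<noteq> 0"
    using assms k by (metis scaleR_zero_left singletonI singletonD span_base span_empty span_insert_0)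
  with k that show thesis by blast
qed

lemma span_singleton_scaleR:
  "k \<noteq> 0 \<Longrightarrow> span {k *\<^sub>R x} = span {x :: 'a::real_vector}"
  using span_image_scale[of "{x}" "\<lambda>_. k"] by simp

lemma proj_pointE:
  assumes "q \<in> proj_points"
  obtains v where "v \<noteq> 0" "q = span {v}"
proof -
  have q: "subspace q" "dim q = 1" using assms by (auto simp: proj_points_def)
  have "\<exists>v\<in>q. v \<noteq> 0"
    using q by (metis dim_eq_0 insert_iff subsetI zero_neq_one empty_iff)
  then obtain v where v: "v \<in> q" "v \<noteq> 0" by blast
  have "span {v} \<subseteq> q" using v q by (simp add: span_minimal)
  moreover have "dim (span {v}) = 1" using v by (simp add: dim_insert)
  ultimately have "q = span {v}"
    using q subspace_dim_equal[of "span {v}" q] by auto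
  with v that show thesis by blast
qed

lemma proj_points_nonzero: "span {v} \<in> proj_points \<Longrightarrow> v \<noteq> 0"
  by (auto simp: proj_points_def)

lemma lifts_scaleR_iff: "k \<noteq> 0 \<Longrightarrow> k *\<^sub>R v \<in> lifts S \<longleftrightarrow> v \<in> lifts S"
  by (simp add: lifts_def span_singleton_scaleR)

text \<open>For the inclusion \<open>\<supseteq>\<close>, a curve with velocity \<open>w\<close> is found by the intermediate value theorem in
  the direction of a vector \<open>n\<close> transversal to the hypersurface.  No continuity of the correction
  \<open>\<tau>\<close> is needed: every zero of \<open>f\<close> at parameter \<open>s\<close> with \<open>\<bar>\<tau>\<bar> \<le> \<bar>s\<bar>\<close> satisfies \<open>\<tau> = o(s)\<close>.\<close>

lemma tangent_hyperplane_eq_kernel: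
  fixes f :: "'a::euclidean_space \<Rightarrow> real"
  assumes S: "S \<subseteq> proj_points" and v: "v \<in> lifts S" and W: "open W" "v \<in> W"
    and f: "continuous_on W f" and f': "(f has_derivative f') (at v)" "f' \<noteq> (\<lambda>_. 0)"
    and zero: "W \<inter> lifts S = {x \<in> W. f x = 0}"
  shows "tangent_hyperplane S (span {v}) = {w. f' w = 0}"
proof -
  have fv: "f v = 0" using zero v W by blast
  have lin: "linear f'" using f' has_derivative_linear by blast
  have v0: "v \<noteq> 0" using v S proj_points_nonzero by (auto simp: lifts_def)
  show ?thesis
  proof (intro set_eqI iffI)
    fix w assume "w \<in> tangent_hyperplane S (span {v})"
    then obtain \<gamma> where g0: "span {\<gamma> 0} = span {v}" and g': "(\<gamma> has_vector_derivative w) (at 0)"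
      and ev: "\<forall>\<^sub>F s in nhds 0. \<gamma> s \<in> lifts S"
      unfolding tangent_hyperplane_def by auto
    obtain k where k: "k \<noteq> 0" "\<gamma> 0 = k *\<^sub>R v"
      using span_singleton_eqD[OF g0 v0] by blast
    \<comment> \<open>The curve may start at another lift of the point; rescaling makes it start at
      \<open>v\<close> and keeps it in the cone.\<close>
    let ?\<delta> = "\<lambda>s. (1 / k) *\<^sub>R \<gamma> s"
    have d0: "?\<delta> 0 = v" using k by simp
    have d': "(?\<delta> has_derivative (\<lambda>s. s *\<^sub>R ((1 / k) *\<^sub>R w))) (at 0)"
      using has_derivative_scaleR_right[OF g'[unfolded has_vector_derivative_def], of "1 / k"]
      by (simp add: mult.commute)
    have "(?\<delta> \<longlongrightarrow> v) (nhds 0)"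
      using has_derivative_continuous[OF d'] d0 continuous_at tendsto_at_iff_tendsto_nhds by metis
    then have "\<forall>\<^sub>F s in nhds 0. ?\<delta> s \<in> W"
      using W topological_tendstoD by blast
    with ev have "\<forall>\<^sub>F s in nhds 0. f (?\<delta> s) = 0"
    proof eventually_elim
      case (elim s)
      then have "?\<delta> s \<in> W \<inter> lifts S" using k by (simp add: lifts_scaleR_iff)
      then show ?case using zero by blast
    qed
    then have "((\<lambda>s. f (?\<delta> s)) has_derivative (\<lambda>_. 0)) (at 0)"
      by (smt (verit, best) eventually_nhds has_derivative_const has_derivative_transform_within_open)
    moreover have "((\<lambda>s. f (?\<delta> s)) has_derivative (\<lambda>s. f' (s *\<^sub>R ((1 / k) *\<^sub>R w)))) (at 0)"
      using has_derivative_compose[OF d'] f' d0 by simp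
    ultimately have "(\<lambda>s. f' (s *\<^sub>R ((1 / k) *\<^sub>R w))) = (\<lambda>_. 0)"
      using has_derivative_unique by blast
    then have "f' (1 *\<^sub>R ((1 / k) *\<^sub>R w)) = 0" by meson
    then show "w \<in> {w. f' w = 0}" using k linear_cmul[OF lin] by simp
  next
    fix w assume "w \<in> {w. f' w = 0}"
    then have w: "f' w = 0" by simp
    obtain n0 where "f' n0 \<noteq> 0" using f' by blast
    \<comment> \<open>With \<open>f' n = 1\<close> and \<open>f' w = 0\<close>, the linear part of
      \<open>f\<close> at the displacement \<open>s *\<^sub>R w + t *\<^sub>R n\<close> is exactly
      \<open>t\<close>.\<close>
    define n where "n = (1 / f' n0) *\<^sub>R n0"
    have n: "f' n = 1" using \<open>f' n0 \<noteq> 0\<close> linear_cmul[OF lin] by (simp add: n_def)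
    have f'h: "f' (s *\<^sub>R w + t *\<^sub>R n) = t" for s t
      using w n linear_cmul[OF lin] linear_add[OF lin] by simp
    define N where "N = norm w + norm n + 1"
    have N: "N > 0" unfolding N_def by (simp add: add_nonneg_pos)
    have nb: "norm (s *\<^sub>R w + t *\<^sub>R n) \<le> \<bar>s\<bar> * N" if "\<bar>t\<bar> \<le> \<bar>s\<bar>" for s t
    proof -
      have "norm (s *\<^sub>R w + t *\<^sub>R n) \<le> \<bar>s\<bar> * norm w + \<bar>t\<bar> * norm n"
        using norm_triangle_ineq[of "s *\<^sub>R w" "t *\<^sub>R n"] by simp
      also have "\<dots> \<le> \<bar>s\<bar> * norm w + \<bar>s\<bar> * norm n"
        using that by (simp add: mult_right_mono)
      finally show ?thesis by (simp add: N_def algebra_simps)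
    qed
    have approx: "\<exists>d>0. \<forall>s t. \<bar>s\<bar> < d \<longrightarrow> \<bar>t\<bar> \<le> \<bar>s\<bar> \<longrightarrow>
        v + (s *\<^sub>R w + t *\<^sub>R n) \<in> W \<and> \<bar>f (v + (s *\<^sub>R w + t *\<^sub>R n)) - t\<bar> \<le> e * \<bar>s\<bar>"
      if e: "e > 0" for e
    proof -
      have "e / N > 0" using e N by simp
      then obtain d1 where d1: "d1 > 0" and
        D1: "\<And>y. norm (y - v) < d1 \<Longrightarrow> norm (f y - f v - f' (y - v)) \<le> e / N * norm (y - v)"
        using f'(1) unfolding has_derivative_at_alt by metis
      obtain d2 where d2: "d2 > 0" "ball v d2 \<subseteq> W"
        using W open_contains_ball by blast
      show ?thesis
      proof (intro exI[of _ "min d1 d2 / N"] conjI allI impI)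
        show "min d1 d2 / N > 0" using d1 d2 N by simp
      next
        fix s t :: real assume s: "\<bar>s\<bar> < min d1 d2 / N" and t: "\<bar>t\<bar> \<le> \<bar>s\<bar>"
        have "\<bar>s\<bar> * N < min d1 d2" using s N by (simp add: pos_less_divide_eq)
        then have h: "norm (s *\<^sub>R w + t *\<^sub>R n) < min d1 d2" using nb[OF t] by linarith
        then show "v + (s *\<^sub>R w + t *\<^sub>R n) \<in> W"
          by (intro subsetD[OF d2(2)]) (simp add: dist_commute[of v], simp add: dist_norm)
        have "\<bar>f (v + (s *\<^sub>R w + t *\<^sub>R n)) - t\<bar> \<le> e / N * norm (s *\<^sub>R w + t *\<^sub>R n)"
          using D1[of "v + (s *\<^sub>R w + t *\<^sub>R n)"] h f'h fv by simp
        also have "\<dots> \<le> e / N * (\<bar>s\<bar> * N)"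
          using nb[OF t] e N by (intro mult_left_mono) auto
        finally show "\<bar>f (v + (s *\<^sub>R w + t *\<^sub>R n)) - t\<bar> \<le> e * \<bar>s\<bar>"
          using N by simp
      qed
    qed
    define \<tau> where "\<tau> = (\<lambda>s. SOME t. \<bar>t\<bar> \<le> \<bar>s\<bar> \<and> f (v + (s *\<^sub>R w + t *\<^sub>R n)) = 0)"
    \<comment> \<open>Tolerance \<open>1\<close> suffices for a change of sign: it gives
      \<open>f \<le> 0\<close> at \<open>t = -\<bar>s\<bar>\<close> and \<open>f \<ge> 0\<close> at
      \<open>t = \<bar>s\<bar>\<close>.\<close>
    obtain d where d: "d > 0" and dW: "\<And>s t. \<bar>s\<bar> < d \<Longrightarrow> \<bar>t\<bar> \<le> \<bar>s\<bar> \<Longrightarrow>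
        v + (s *\<^sub>R w + t *\<^sub>R n) \<in> W \<and> \<bar>f (v + (s *\<^sub>R w + t *\<^sub>R n)) - t\<bar> \<le> 1 * \<bar>s\<bar>"
      using approx[of 1] by auto
    have \<tau>: "\<bar>\<tau> s\<bar> \<le> \<bar>s\<bar>" "f (v + (s *\<^sub>R w + \<tau> s *\<^sub>R n)) = 0" if s: "\<bar>s\<bar> < d" for s
    proof -
      have "\<exists>t\<ge>-\<bar>s\<bar>. t \<le> \<bar>s\<bar> \<and> f (v + (s *\<^sub>R w + t *\<^sub>R n)) = 0"
      proof (rule IVT')
        show "f (v + (s *\<^sub>R w + (-\<bar>s\<bar>) *\<^sub>R n)) \<le> 0" using dW[OF s, of "-\<bar>s\<bar>"] by auto
        show "0 \<le> f (v + (s *\<^sub>R w + \<bar>s\<bar> *\<^sub>R n))" using dW[OF s, of "\<bar>s\<bar>"] by auto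
        show "continuous_on {-\<bar>s\<bar>..\<bar>s\<bar>} (\<lambda>t. f (v + (s *\<^sub>R w + t *\<^sub>R n)))"
          by (rule continuous_on_compose2[OF f]) (use dW[OF s] in \<open>auto intro!: continuous_intros\<close>)
      qed simp
      then have "\<exists>t. \<bar>t\<bar> \<le> \<bar>s\<bar> \<and> f (v + (s *\<^sub>R w + t *\<^sub>R n)) = 0"
        by (metis abs_le_iff minus_le_iff)
      from someI_ex[OF this] show "\<bar>\<tau> s\<bar> \<le> \<bar>s\<bar>" "f (v + (s *\<^sub>R w + \<tau> s *\<^sub>R n)) = 0"
        unfolding \<tau>_def by auto
    qed
    define \<gamma> where "\<gamma> = (\<lambda>s. v + (s *\<^sub>R w + \<tau> s *\<^sub>R n))"
    have g0: "\<gamma> 0 = v" using \<tau>(1)[of 0] d by (simp add: \<gamma>_def)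
    have "(\<gamma> has_vector_derivative w) (at 0)"
      unfolding has_vector_derivative_def has_derivative_at_alt
    proof (intro conjI allI impI bounded_linear_scaleR_left)
      fix e :: real assume e: "e > 0"
      have "e / (norm n + 1) > 0" using e by (simp add: add_nonneg_pos)
      then obtain d' where d': "d' > 0" and D': "\<And>s t. \<bar>s\<bar> < d' \<Longrightarrow> \<bar>t\<bar> \<le> \<bar>s\<bar> \<Longrightarrow>
         \<bar>f (v + (s *\<^sub>R w + t *\<^sub>R n)) - t\<bar> \<le> e / (norm n + 1) * \<bar>s\<bar>"
        using approx[of "e / (norm n + 1)"] by auto
      show "\<exists>d>0. \<forall>y. norm (y - 0) < d \<longrightarrow>
          norm (\<gamma> y - \<gamma> 0 - (y - 0) *\<^sub>R w) \<le> e * norm (y - 0)"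
      proof (intro exI[of _ "min d d'"] conjI allI impI)
        fix s :: real assume "norm (s - 0) < min d d'"
        then have s: "\<bar>s\<bar> < d" "\<bar>s\<bar> < d'" by auto
        \<comment> \<open>As \<open>f\<close> vanishes at the corrected point, the approximation
          error there is \<open>\<tau> s\<close> itself up to sign.\<close>
        have "\<bar>\<tau> s\<bar> \<le> e / (norm n + 1) * \<bar>s\<bar>"
          using D'[OF s(2) \<tau>(1)[OF s(1)]] \<tau>(2)[OF s(1)] by simp
        then have "\<bar>\<tau> s\<bar> * norm n \<le> e / (norm n + 1) * \<bar>s\<bar> * (norm n + 1)"
          using e by (intro mult_mono) auto
        also have "\<dots> = e * \<bar>s\<bar>" by (simp add: add_nonneg_eq_0_iff)
        finally show "norm (\<gamma> s - \<gamma> 0 - (s - 0) *\<^sub>R w) \<le> e * norm (s - 0)"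
          by (simp add: g0) (simp add: \<gamma>_def)
      qed (use d d' in auto)
    qed
    moreover have "\<forall>\<^sub>F s in nhds 0. \<gamma> s \<in> lifts S"
    proof -
      have "\<gamma> s \<in> lifts S" if "\<bar>s\<bar> < d" for s
        using dW[OF that \<tau>(1)[OF that]] \<tau>(2)[OF that] zero unfolding \<gamma>_def by blast
      then show ?thesis
        unfolding eventually_nhds_metric using d by (auto simp: dist_real_def)
    qed
    ultimately show "w \<in> tangent_hyperplane S (span {v})"
      unfolding tangent_hyperplane_def using g0 by blast
  qed
qed

text \<open>The image under \<open>x\<close> of a straight line through \<open>z\<close> is a curve
  in the cone with velocity \<open>X w\<close>. The main use is for the base point of a reflection
  as a function of the reflected point.\<close>

lemma tangent_hyperplaneI:
  fixes x :: "'b::real_normed_vector \<Rightarrow> 'a::euclidean_space"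
  assumes x: "(x has_derivative X) (at z)" and W: "open W" "z \<in> W"
    and S: "\<And>y. y \<in> W \<Longrightarrow> x y \<in> lifts S"
  shows "X w \<in> tangent_hyperplane S (span {x z})"
proof -
  let ?\<gamma> = "\<lambda>s::real. x (z + s *\<^sub>R w)"
  have line: "((\<lambda>s::real. z + s *\<^sub>R w) has_derivative (\<lambda>s. s *\<^sub>R w)) (at 0)"
    by (auto intro!: derivative_eq_intros)
  have "(?\<gamma> has_derivative (\<lambda>s. X (s *\<^sub>R w))) (at 0)"
    using has_derivative_compose[OF line, of x X] x by simp
  then have "(?\<gamma> has_vector_derivative X w) (at 0)"
    unfolding has_vector_derivative_def
    using linear_cmul[OF has_derivative_linear[OF x]] by simp
  moreover have "\<forall>\<^sub>F s in nhds 0. ?\<gamma> s \<in> lifts S"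
  proof -
    have "open ((\<lambda>s::real. z + s *\<^sub>R w) -` W)"
      by (intro open_vimage W continuous_intros)
    moreover have "0 \<in> (\<lambda>s::real. z + s *\<^sub>R w) -` W" using W by simp
    ultimately show ?thesis
      unfolding eventually_nhds using S by blast
  qed
  ultimately show ?thesis
    unfolding tangent_hyperplane_def by (intro CollectI exI[of _ ?\<gamma>]) simp
qed

section \<open>Projective lines and affine midpoints\<close>

lemma span_two_lines: "span (span {x} \<union> span {y}) = {a *\<^sub>R x + b *\<^sub>R y |a b. True}"
  unfolding span_Un span_span by (auto simp: span_singleton)

lemma span_singleton_eq_nonzero: "span {x} = span {y} \<Longrightarrow> x \<noteq> 0 \<Longrightarrow> y \<noteq> (0 :: 'a::real_vector)"
  using span_base[of x "{x}"] by (auto simp: span_singleton)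

lemma midpoint_add_diff: "midpoint (m + y) (m - y) = (m :: 'a::real_vector)"
proof -
  have "(m + y) + (m - y) = m + m" by simp
  then show ?thesis by (simp only: midpoint_def inverse_eq_divide scaleR_half_double)
qed

lemma diff_midpoint:
  fixes a b :: "'a::real_vector"
  shows "a - midpoint a b = (1 / 2) *\<^sub>R (a - b)"
proof -
  have "(1 / 2) *\<^sub>R (a - b) = (1 / 2) *\<^sub>R ((a + a) - (a + b))" by simp
  then show ?thesis
    by (simp only: scaleR_diff_right[of _ "a + a"] scaleR_half_double midpoint_def inverse_eq_divide)
qed

lemma midpoint_reflect:
  fixes a b :: "'a::real_vector"
  shows "midpoint a b - (a - midpoint a b) = b"
proof -
  have "midpoint a b + midpoint a b = a + b" by (rule midpoint_plus_self)
  then show ?thesis by (simp add: algebra_simps)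
qed

lemma diff_eq_add_imp_zero:
  assumes "m - y = m + (y :: 'a::real_vector)"
  shows "y = 0"
proof -
  have "2 *\<^sub>R y = (m + y) - (m - y)" by (simp add: scaleR_2)
  also have "\<dots> = 0" unfolding assms by (rule diff_self)
  finally show ?thesis by simp
qed

section \<open>Symplectic geometry\<close>

locale symplectic =
  fixes \<omega> :: "'a::euclidean_space \<Rightarrow> 'a \<Rightarrow> real"
  assumes symplectic: "symplectic_form \<omega>"
begin

sublocale bounded_bilinear \<omega>
  using symplectic bilinear_conv_bounded_bilinear unfolding symplectic_form_def by blast

lemma self [simp]: "\<omega> v v = 0"
  using symplectic unfolding symplectic_form_def by blast

lemma skew: "\<omega> w v = - \<omega> v w"
  using self[of "v + w"] unfolding add_left add_right by simp

lemma nondegenerate: "(\<And>w. \<omega> v w = 0) \<Longrightarrow> v = 0"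
  using symplectic unfolding symplectic_form_def by blast

text \<open>\<open>A\<close> is the matrix of \<open>\<omega>\<close> with respect to the inner
  product. Nondegeneracy makes it injective, hence invertible in finite dimension, and
  \<open>J\<close> is its inverse. It turns Euclidean normals and gradients into symplectic
  ones.\<close>

lemma symplectic_gradient:
  obtains J where "linear J" "\<And>n w. \<omega> (J n) w = n \<bullet> w"
proof -
  define A where "A = (\<lambda>v. \<Sum>b\<in>Basis. \<omega> v b *\<^sub>R b)"
  have A: "A v \<bullet> w = \<omega> v w" for v w
  proof -
    have "\<omega> v w = \<omega> v (\<Sum>b\<in>Basis. (w \<bullet> b) *\<^sub>R b)" by (simp add: euclidean_representation)
    also have "\<dots> = (\<Sum>b\<in>Basis. (w \<bullet> b) * \<omega> v b)" by (simp add: sum_right scaleR_right)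
    finally show ?thesis
      by (simp add: A_def inner_sum_left inner_commute[of w] mult.commute)
  qed
  have lin: "linear A"
    by (intro linearI) (simp_all add: A_def add_left scaleR_left scaleR_left.add sum.distrib scaleR_sum_right)
  have "v = 0" if "A v = 0" for v
    using that A nondegenerate[of v] by (metis inner_zero_left)
  then have "inj A" using linear_injective_0[OF lin] by blast
  then obtain J where J: "linear J" "A \<circ> J = id"
    using linear_surjective_right_inverse[OF lin linear_injective_imp_surjective[OF lin]] by blast
  have "\<omega> (J n) w = n \<bullet> w" for n w
    using A[of "J n" w] J(2) by (metis comp_apply id_apply)
  with J that show thesis by blast
qed

text \<open>A functional vanishing on a hyperplane is a multiple of the functional that defines it,
  and nondegeneracy carries this over to vectors. Contact points and dual points are computed in
  this way.\<close>

lemma symp_orth_kernel: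
  assumes "p \<noteq> 0"
  shows "symp_orth \<omega> {w. \<omega> p w = 0} = span {p}"
proof (intro equalityI subsetI)
  fix v assume "v \<in> symp_orth \<omega> {w. \<omega> p w = 0}"
  then have v: "\<omega> v w = 0" if "\<omega> p w = 0" for w using that by (auto simp: symp_orth_def)
  obtain n where n: "\<omega> p n \<noteq> 0" using assms nondegenerate by blast
  have "\<omega> (v - (\<omega> v n / \<omega> p n) *\<^sub>R p) w = 0" for w
  proof -
    have "\<omega> v (w - (\<omega> p w / \<omega> p n) *\<^sub>R n) = 0"
      using n by (intro v) (simp add: diff_right scaleR_right)
    then show ?thesis by (simp add: diff_left diff_right scaleR_right scaleR_left)
  qed
  then have "v - (\<omega> v n / \<omega> p n) *\<^sub>R p = 0" by (rule nondegenerate)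
  then show "v \<in> span {p}" by (auto simp: span_singleton)
qed (auto simp: symp_orth_def span_singleton scaleR_left)

lemma proj_hyperplaneE:
  assumes "proj_hyperplane H"
  obtains p where "p \<noteq> 0" "H = {w. \<omega> p w = 0}"
proof -
  have H: "span H = H" "dim H = DIM('a) - 1"
    using assms by (simp_all add: proj_hyperplane_def span_eq_iff)
  obtain n where n: "n \<noteq> 0" "H = {x. n \<bullet> x = 0}"
    using lowdim_eq_hyperplane[OF H(2)] H(1) by auto
  obtain J where J: "linear J" "\<And>n w. \<omega> (J n) w = n \<bullet> w"
    using symplectic_gradient by blast
  show thesis
  proof
    show "H = {w. \<omega> (J n) w = 0}" using n J by simp
    show "J n \<noteq> 0" using n J(2)[of n n] by (auto simp: zero_left)
  qed
qed

text \<open>\<open>n\<close> is the Hamiltonian vector field of a local equation \<open>f\<close> of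
  the cone. Its differentiability, which comes from the second derivatives of \<open>f\<close>,
  allows the characteristic line to be differentiated in the base point.\<close>

lemma table_gradient:
  assumes S: "table S" and v: "v \<in> lifts S"
  obtains W n where "open W" "v \<in> W" "\<forall>x\<in>W. n differentiable (at x)"
    "\<forall>x\<in>W \<inter> lifts S. n x \<noteq> 0 \<and> tangent_hyperplane S (span {x}) = {w. \<omega> (n x) w = 0} \<and>
       dual_point \<omega> S (span {x}) = span {n x} \<and> \<omega> (n x) x = 0"
proof -
  have Sp: "S \<subseteq> proj_points" using S by (simp add: table_def)
  obtain W and f :: "'a \<Rightarrow> real" where W: "v \<in> W" "smooth_on W f"
    and crit: "\<And>x. x \<in> W \<Longrightarrow> frechet_derivative f (at x) \<noteq> (\<lambda>_. 0)"
    and zero: "W \<inter> lifts S = {x \<in> W. f x = 0}"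
    using S v unfolding table_def by metis
  have opW: "open W" using W by (simp add: smooth_on_def)
  note df = smooth_on_has_derivative[OF W(2)]
  obtain J where J: "linear J" "\<And>n w. \<omega> (J n) w = n \<bullet> w"
    using symplectic_gradient by blast
  define n where "n = (\<lambda>x. J (\<Sum>b\<in>Basis. frechet_derivative f (at x) b *\<^sub>R b))"
  have n: "\<omega> (n x) w = frechet_derivative f (at x) w" if "x \<in> W" for x w
  proof -
    interpret D: linear "frechet_derivative f (at x)"
      using df[OF that] has_derivative_linear by blast
    have "\<omega> (n x) w = (\<Sum>b\<in>Basis. (w \<bullet> b) * frechet_derivative f (at x) b)"
      by (simp add: n_def J inner_sum_left inner_commute[of w] mult.commute)
    also have "\<dots> = frechet_derivative f (at x) (\<Sum>b\<in>Basis. (w \<bullet> b) *\<^sub>R b)"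
      by (simp add: D.sum D.scaleR)
    finally show ?thesis by (simp add: euclidean_representation)
  qed
  have n0: "n x \<noteq> 0" if "x \<in> W" for x
    using n[OF that] crit[OF that] by (auto simp: zero_left)
  have tan: "tangent_hyperplane S (span {x}) = {w. \<omega> (n x) w = 0}" if "x \<in> W" "x \<in> lifts S" for x
  proof -
    have "continuous_on W f"
      using df has_derivative_continuous continuous_at_imp_continuous_on by blast
    from tangent_hyperplane_eq_kernel[OF Sp that(2) opW that(1) this df[OF that(1)] crit[OF that(1)] zero]
    show ?thesis by (simp add: n[OF that(1)])
  qed
  have "n differentiable (at x)" if "x \<in> W" for x
  proof -
    have "(\<lambda>x. \<Sum>b\<in>Basis. frechet_derivative f (at x) b *\<^sub>R b) differentiable (at x)"
      using smooth_on_differentiable_derivative[OF W(2) that] by (intro derivative_intros) simp_all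
    then show ?thesis
      unfolding n_def
      by (rule differentiable_compose[rotated]) (simp add: linear_imp_differentiable J)
  qed
  moreover have "\<omega> (n x) x = 0" if "x \<in> W" "x \<in> lifts S" for x
  proof -
    \<comment> \<open>The ray through \<open>x\<close> stays in the cone, so \<open>x\<close> is
      itself a tangent vector.\<close>
    have "((\<lambda>s. s *\<^sub>R x) has_derivative (\<lambda>s. s *\<^sub>R x)) (at (1::real))"
      by (auto intro!: derivative_eq_intros)
    from tangent_hyperplaneI[OF this, of "- {0}" S 1]
    have "x \<in> tangent_hyperplane S (span {x})"
      using that by (simp add: lifts_scaleR_iff open_Compl)
    then show ?thesis using tan[OF that] by simp
  qed
  moreover have "dual_point \<omega> S (span {x}) = span {n x}" if "x \<in> W" "x \<in> lifts S" for x
    unfolding dual_point_def contact_point_def tan[OF that] using symp_orth_kernel n0[OF that(1)] .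
  ultimately show thesis
    using that[of W n] opW W(1) n0 tan by blast
qed

text \<open>The hypothesis \<open>ker\<close> says that \<open>\<omega> z\<close> is proportional to \<open>\<gamma> z w = \<omega> (z - x z) (X z w)\<close>.  The
  proof takes the exterior derivative of this relation, in the division-free form
  \<open>\<omega> z w * \<gamma> z w\<^sub>0 = \<omega> z w\<^sub>0 * \<gamma> z w\<close>, and evaluates it on \<open>y\<close>.\<close>

lemma contact_form_not_basic:
  assumes W: "open W" "z\<^sub>0 \<in> W"
    and X: "\<And>z. z \<in> W \<Longrightarrow> (x has_derivative X z) (at z)"
    and X2: "\<And>w. (\<lambda>z. X z w) differentiable (at z\<^sub>0)"
    and ker: "\<And>z w. z \<in> W \<Longrightarrow> \<omega> z w = 0 \<Longrightarrow> \<omega> (z - x z) (X z w) = 0"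
    and y: "y = z\<^sub>0 - x z\<^sub>0" and Xy: "X z\<^sub>0 y = 0" and zy: "\<omega> z\<^sub>0 y = 0"
    and w0: "\<omega> y (X z\<^sub>0 w\<^sub>0) \<noteq> 0"
  shows "y \<in> span {z\<^sub>0}"
proof -
  define \<gamma> where "\<gamma> = (\<lambda>z w. \<omega> (z - x z) (X z w))"
  obtain X' where X': "\<And>w. ((\<lambda>z. X z w) has_derivative (\<lambda>v. X' v w)) (at z\<^sub>0)"
  proof -
    have "\<forall>w. \<exists>D. ((\<lambda>z. X z w) has_derivative D) (at z\<^sub>0)"
      using X2 by (simp add: differentiable_def)
    then obtain D where "\<And>w. ((\<lambda>z. X z w) has_derivative D w) (at z\<^sub>0)" by metis
    then show thesis by (intro that[of "\<lambda>v w. D w v"]) simp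
  qed
  have lin: "linear (X z)" if "z \<in> W" for z
    using X[OF that] has_derivative_linear by blast
  \<comment> \<open>Pairing with the fixed vector \<open>y\<close> gives a real function, whose
    second derivatives commute.\<close>
  have sym: "\<omega> y (X' v w) = \<omega> y (X' w v)" for v w
    by (rule second_derivative_symmetric[where f = "\<lambda>z. \<omega> y (x z)" and f' = "\<lambda>z u. \<omega> y (X z u)", OF W,
          where Du = "\<lambda>v. \<omega> y (X' v w)" and Dv = "\<lambda>w. \<omega> y (X' w v)"])
      (auto intro!: bounded_linear.has_derivative[OF bounded_linear_right] X X')
  have cross: "\<omega> z w * \<gamma> z w\<^sub>0 = \<omega> z w\<^sub>0 * \<gamma> z w" if "z \<in> W" for z w
  proof -
    \<comment> \<open>The argument is the combination of \<open>w\<close> and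
      \<open>w\<^sub>0\<close> that \<open>\<omega> z\<close> annihilates.\<close>
    have "\<gamma> z (\<omega> z w *\<^sub>R w\<^sub>0 - \<omega> z w\<^sub>0 *\<^sub>R w) = 0"
      unfolding \<gamma>_def using that by (intro ker) (simp_all add: diff_right scaleR_right)
    then show ?thesis
      by (simp add: \<gamma>_def linear_diff[OF lin[OF that]] linear_cmul[OF lin[OF that]] diff_right scaleR_right)
  qed
  define D where "D = (\<lambda>v w. \<omega> (v - X z\<^sub>0 v) (X z\<^sub>0 w) + \<omega> y (X' v w))"
  have D: "((\<lambda>z. \<gamma> z w) has_derivative (\<lambda>v. D v w)) (at z\<^sub>0)" for w
    unfolding \<gamma>_def D_def y
    by (rule FDERIV[THEN has_derivative_eq_rhs]) (auto intro!: derivative_eq_intros X X' W simp: fun_eq_iff)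
  have eq: "\<omega> v w * \<gamma> z\<^sub>0 w\<^sub>0 + \<omega> z\<^sub>0 w * D v w\<^sub>0 = \<omega> v w\<^sub>0 * \<gamma> z\<^sub>0 w + \<omega> z\<^sub>0 w\<^sub>0 * D v w" for v w
  proof -
    have der: "((\<lambda>z. \<omega> z a * \<gamma> z b) has_derivative (\<lambda>v. \<omega> z\<^sub>0 a * D v b + \<omega> v a * \<gamma> z\<^sub>0 b)) (at z\<^sub>0)" for a b
      by (intro has_derivative_mult D bounded_linear_imp_has_derivative bounded_linear_left)
    have "((\<lambda>z. \<omega> z w\<^sub>0 * \<gamma> z w) has_derivative (\<lambda>v. \<omega> z\<^sub>0 w * D v w\<^sub>0 + \<omega> v w * \<gamma> z\<^sub>0 w\<^sub>0)) (at z\<^sub>0)"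
      by (rule has_derivative_transform_within_open[OF der W]) (rule cross)
    from fun_cong[OF has_derivative_unique[OF this der], of v] show ?thesis by simp
  qed
  have "\<omega> z\<^sub>0 w\<^sub>0 \<noteq> 0" using ker[OF W(2)] w0 y by blast
  have g0: "\<gamma> z\<^sub>0 w\<^sub>0 \<noteq> 0" using w0 by (simp add: \<gamma>_def y)
  have "\<exists>k. \<forall>w. \<omega> y w = k * \<omega> z\<^sub>0 w"
  proof (intro exI allI)
    fix w
    \<comment> \<open>The left side is the exterior derivative of \<open>\<gamma>\<close> on
      \<open>y\<close> and \<open>w\<close>: the second derivatives cancel by \<open>sym\<close>,
      and \<open>X z\<^sub>0 y = 0\<close> leaves a single term.\<close>
    have "D y w - D w y = \<omega> y (X z\<^sub>0 w)"
      unfolding D_def using sym[of y w] Xy by (simp add: zero_right)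
    moreover have "\<gamma> z\<^sub>0 y = 0" using Xy by (simp add: \<gamma>_def zero_right)
    moreover have "\<omega> y (X z\<^sub>0 w) = \<gamma> z\<^sub>0 w" by (simp add: \<gamma>_def y)
    ultimately have "D y w = D w y + \<gamma> z\<^sub>0 w" by simp
    \<comment> \<open>This is the difference of \<open>eq\<close> at \<open>y, w\<close> and at
      \<open>w, y\<close>; the factor 2 comes from skew symmetry.\<close>
    then have "2 * \<omega> y w * \<gamma> z\<^sub>0 w\<^sub>0 = \<omega> y w\<^sub>0 * \<gamma> z\<^sub>0 w - \<omega> z\<^sub>0 w * D y w\<^sub>0 + \<omega> z\<^sub>0 w\<^sub>0 * \<gamma> z\<^sub>0 w"
      using eq[of y w] eq[of w y] skew[of w y] zy \<open>\<gamma> z\<^sub>0 y = 0\<close> by (simp add: algebra_simps)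
    moreover have "\<gamma> z\<^sub>0 w = \<omega> z\<^sub>0 w * \<gamma> z\<^sub>0 w\<^sub>0 / \<omega> z\<^sub>0 w\<^sub>0"
      using cross[OF W(2), of w] \<open>\<omega> z\<^sub>0 w\<^sub>0 \<noteq> 0\<close> by (simp add: field_simps)
    ultimately have "2 * \<gamma> z\<^sub>0 w\<^sub>0 * \<omega> y w
        = (\<omega> y w\<^sub>0 * \<gamma> z\<^sub>0 w\<^sub>0 / \<omega> z\<^sub>0 w\<^sub>0 - D y w\<^sub>0 + \<gamma> z\<^sub>0 w\<^sub>0) * \<omega> z\<^sub>0 w"
      using \<open>\<omega> z\<^sub>0 w\<^sub>0 \<noteq> 0\<close> by (simp add: algebra_simps)
    then show "\<omega> y w = (\<omega> y w\<^sub>0 * \<gamma> z\<^sub>0 w\<^sub>0 / \<omega> z\<^sub>0 w\<^sub>0 - D y w\<^sub>0 + \<gamma> z\<^sub>0 w\<^sub>0) / (2 * \<gamma> z\<^sub>0 w\<^sub>0) * \<omega> z\<^sub>0 w"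
      using g0 by (simp add: nonzero_eq_divide_eq mult.commute)
  qed
  then obtain k where "\<And>w. \<omega> (y - k *\<^sub>R z\<^sub>0) w = 0"
    by (auto simp: diff_left scaleR_left)
  then have "y - k *\<^sub>R z\<^sub>0 = 0" by (rule nondegenerate)
  then show ?thesis by (auto simp: span_singleton)
qed

lemma contact_hyperplane_span: "w \<in> contact_hyperplane \<omega> (span {v}) \<longleftrightarrow> \<omega> v w = 0"
  using skew[of v w]
  by (auto simp: contact_hyperplane_def symp_orth_def span_singleton scaleR_right)

lemma differentiable_right: "g differentiable (at z) \<Longrightarrow> (\<lambda>z. \<omega> a (g z)) differentiable (at z)"
  using bounded_linear.has_derivative[OF bounded_linear_right] unfolding differentiable_def by blast

end

section \<open>Comparison of the reflection rules\<close>

text \<open>\<open>p\<close> is a lift of the contact point of \<open>H\<close>. The translates of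
  \<open>H\<close> that represent the affine chart are the level sets of \<open>\<omega> p\<close>
  at nonzero values.\<close>

locale midpoint_table = symplectic +
  fixes p :: 'a and H :: "'a set" and S :: "'a set set"
  assumes p: "p \<noteq> 0" and H: "H = {w. \<omega> p w = 0}" and S: "table S"
begin

lemma contact_point_H: "contact_point \<omega> H = span {p}"
  unfolding contact_point_def H by (rule symp_orth_kernel[OF p])

lemma tangent_dual:
  assumes "x \<in> lifts S"
  obtains n where "n \<noteq> 0" "tangent_hyperplane S (span {x}) = {w. \<omega> n w = 0}"
    "dual_point \<omega> S (span {x}) = span {n}" "\<omega> n x = 0"
proof -
  obtain W n where "x \<in> W" and n: "\<forall>x\<in>W \<inter> lifts S. n x \<noteq> 0 \<and>
      tangent_hyperplane S (span {x}) = {w. \<omega> (n x) w = 0} \<and>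
      dual_point \<omega> S (span {x}) = span {n x} \<and> \<omega> (n x) x = 0"
    using table_gradient[OF S assms] by metis
  then show thesis using assms that[of "n x"] by blast
qed

lemma generalized_cone_iff:
  "generalized_cone S (contact_point \<omega> H) \<longleftrightarrow> (\<forall>x\<in>lifts S. p \<in> tangent_hyperplane S (span {x}))"
proof -
  have sub: "span {p} \<subseteq> tangent_hyperplane S (span {x}) \<longleftrightarrow> p \<in> tangent_hyperplane S (span {x})"
    if x: "x \<in> lifts S" for x
  proof -
    obtain n where "tangent_hyperplane S (span {x}) = {w. \<omega> n w = 0}"
      using tangent_dual[OF x] by metis
    then show ?thesis
      using span_base[of p "{p}"] by (simp add: span_singleton image_subset_iff scaleR_right) blast
  qed
  show ?thesis
  proof (intro iffI ballI)
    fix x assume "generalized_cone S (contact_point \<omega> H)" "x \<in> lifts S"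
    then show "p \<in> tangent_hyperplane S (span {x})"
      using sub[of x] by (simp add: generalized_cone_def contact_point_H lifts_def)
  next
    assume cone: "\<forall>x\<in>lifts S. p \<in> tangent_hyperplane S (span {x})"
    show "generalized_cone S (contact_point \<omega> H)"
      unfolding generalized_cone_def contact_point_H
    proof
      fix q assume "q \<in> S"
      moreover from this have "q \<in> proj_points" using S by (auto simp: table_def)
      then obtain x where "q = span {x}" by (elim proj_pointE)
      ultimately have "x \<in> lifts S" by (simp add: lifts_def)
      then show "span {p} \<subseteq> tangent_hyperplane S q"
        using cone sub \<open>q = span {x}\<close> by blast
    qed
  qed
qed

text \<open>The midpoint may be computed in any translate of \<open>H\<close>. Here the one through
  \<open>z\<close> is taken, and \<open>z'\<close> is scaled into it, so that the lift
  \<open>m\<close> of the base point is an explicit expression in \<open>z\<close> and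
  \<open>z'\<close>.\<close>

lemma midpoint_rule_normal_form:
  assumes R: "midpoint_rule \<omega> H S q (span {z}) (span {z'})"
  defines "m \<equiv> (1 / 2) *\<^sub>R (z + (\<omega> p z / \<omega> p z') *\<^sub>R z')"
  shows "\<omega> p z \<noteq> 0" "\<omega> p z' \<noteq> 0" "q = span {m}" "m \<in> lifts S" "\<omega> p m = \<omega> p z"
    "z - m \<in> characteristic_line \<omega> S (span {m})" "z - m \<noteq> 0" "dual_point \<omega> S (span {m}) \<noteq> span {m}"
proof -
  obtain a a' where a: "a \<notin> H" "a' - a \<in> H" "span {z} = span {a}" "span {z'} = span {a'}"
    "q = span {midpoint a a'}"
    using R unfolding midpoint_rule_def affine_midpoint_def by blast
  have pa: "\<omega> p a \<noteq> 0" "\<omega> p a' = \<omega> p a" using a by (auto simp: H diff_right)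
  then have a0: "a \<noteq> 0" "a' \<noteq> 0" by (auto simp: zero_right)
  obtain k where k: "k \<noteq> 0" "z = k *\<^sub>R a"
    using span_singleton_eqD[OF a(3) a0(1)] by metis
  obtain k' where k': "k' \<noteq> 0" "z' = k' *\<^sub>R a'"
    using span_singleton_eqD[OF a(4) a0(2)] by metis
  show pz: "\<omega> p z \<noteq> 0" "\<omega> p z' \<noteq> 0" using pa k k' by (simp_all add: scaleR_right)
  \<comment> \<open>As \<open>\<omega> p\<close> agrees on \<open>a\<close> and \<open>a'\<close>,
    the scaling factor in \<open>m\<close> is \<open>k / k'\<close>.\<close>
  have m: "m = k *\<^sub>R midpoint a a'"
    using pa k k' by (simp add: m_def scaleR_right midpoint_def scaleR_add_right)
  then show q: "q = span {m}" using a k by (simp add: span_singleton_scaleR)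
  then show "m \<in> lifts S" "dual_point \<omega> S (span {m}) \<noteq> span {m}"
    using R by (auto simp: midpoint_rule_def lifts_def)
  show "\<omega> p m = \<omega> p z" using pz by (simp add: m_def scaleR_right add_right)
  have "z \<in> characteristic_line \<omega> S q"
    using R span_base[of z "{z}"] by (auto simp: midpoint_rule_def)
  moreover have "m \<in> characteristic_line \<omega> S q"
    unfolding characteristic_line_def q by (simp add: span_base)
  ultimately show "z - m \<in> characteristic_line \<omega> S (span {m})"
    unfolding q characteristic_line_def by (rule span_diff)
  show "z - m \<noteq> 0"
  proof
    assume "z - m = 0"
    then have "midpoint a a' = a" using k m by simp
    then have "a = a'" by (simp only: midpoint_eq_endpoint)
    then show False using R a by (simp add: midpoint_rule_def)
  qed
qed

lemma characteristic_lineE: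
  assumes "x \<in> lifts S" and "y \<in> characteristic_line \<omega> S (span {x})"
    and "dual_point \<omega> S (span {x}) = span {n}"
  obtains a b where "y = a *\<^sub>R x + b *\<^sub>R n"
  using assms unfolding characteristic_line_def by (auto simp: span_two_lines)

lemma span_subset_characteristic_line:
  assumes "dual_point \<omega> S (span {x}) = span {n}"
  shows "span {a *\<^sub>R x + b *\<^sub>R n} \<subseteq> characteristic_line \<omega> S (span {x})"
proof -
  have "a *\<^sub>R x + b *\<^sub>R n \<in> characteristic_line \<omega> S (span {x})"
    unfolding characteristic_line_def assms span_two_lines by blast
  then show ?thesis
    unfolding characteristic_line_def by (simp add: span_minimal)
qed

text \<open>The vector on the right is the combination of \<open>x\<close> and \<open>n\<close> that
  \<open>\<omega> p\<close> kills. For \<open>x\<close> outside \<open>H\<close> and not parallel to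
  \<open>n\<close>, it lifts the point at infinity of the characteristic line. The factor on the
  left avoids a division.\<close>

lemma parallel_direction_at_infinity:
  assumes "x \<in> lifts S" "y \<in> characteristic_line \<omega> S (span {x})" "\<omega> p y = 0"
    and "dual_point \<omega> S (span {x}) = span {n}"
  shows "\<exists>b. \<omega> p x *\<^sub>R y = b *\<^sub>R (\<omega> p x *\<^sub>R n - \<omega> p n *\<^sub>R x)"
proof -
  obtain a b where y: "y = a *\<^sub>R x + b *\<^sub>R n"
    using characteristic_lineE[OF assms(1,2,4)] .
  then have "a * \<omega> p x = - (b * \<omega> p n)"
    using assms(3) by (simp add: add_right scaleR_right eq_neg_iff_add_eq_0)
  then have "(\<omega> p x * a) *\<^sub>R x = (- (b * \<omega> p n)) *\<^sub>R x" by (simp add: mult.commute)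
  then show ?thesis
    by (intro exI[of _ b]) (simp add: y scaleR_add_right scaleR_diff_right mult.commute)
qed

text \<open>Tangency of \<open>p\<close> means \<open>\<omega> p n = 0\<close>, so the dual point is
  at infinity; harmonic conjugation with respect to \<open>q\<close> and a point at infinity is
  affine reflection in \<open>q\<close>.\<close>

lemma rules_agree_if_tangent:
  assumes x: "x \<in> lifts S" "x \<notin> H" and tan: "p \<in> tangent_hyperplane S (span {x})"
  shows "midpoint_rule \<omega> H S (span {x}) Z Z' \<longleftrightarrow> outer_rule \<omega> S (span {x}) Z Z'"
proof -
  obtain n where n: "n \<noteq> 0" "tangent_hyperplane S (span {x}) = {w. \<omega> n w = 0}"
    "dual_point \<omega> S (span {x}) = span {n}"
    using tangent_dual[OF x(1)] by metis
  have pn: "\<omega> p n = 0" using tan n(2) skew[of p n] by simp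
  have px: "\<omega> p x \<noteq> 0" using x H by simp
  then have x0: "x \<noteq> 0" by (auto simp: zero_right)
  have q: "span {x} \<in> S" using x by (simp add: lifts_def)
  show ?thesis
  proof
    assume R: "midpoint_rule \<omega> H S (span {x}) Z Z'"
    then obtain a a' where a: "a \<notin> H" "a' - a \<in> H" "Z = span {a}" "Z' = span {a'}"
      "span {x} = span {midpoint a a'}"
      unfolding midpoint_rule_def affine_midpoint_def by blast
    let ?m = "midpoint a a'" and ?y = "a - midpoint a a'"
    have y: "?y = (1 / 2) *\<^sub>R (a - a')"
      by (rule diff_midpoint)
    have "a \<noteq> a'" using R a by (auto simp: midpoint_rule_def)
    then have y0: "?y \<noteq> 0" using y by simp
    have "a \<in> characteristic_line \<omega> S (span {x})"
      using R a span_base[of a "{a}"] by (auto simp: midpoint_rule_def)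
    moreover have "?m \<in> characteristic_line \<omega> S (span {x})"
      unfolding characteristic_line_def a(5) by (simp add: span_base)
    ultimately have "?y \<in> characteristic_line \<omega> S (span {x})"
      unfolding characteristic_line_def by (rule span_diff)
    moreover have "\<omega> p ?y = 0" using a by (simp add: y H diff_right scaleR_right)
    ultimately obtain b where "\<omega> p x *\<^sub>R ?y = b *\<^sub>R (\<omega> p x *\<^sub>R n - \<omega> p n *\<^sub>R x)"
      using parallel_direction_at_infinity[OF x(1) _ _ n(3)] by blast
    then have "\<omega> p x *\<^sub>R (?y - b *\<^sub>R n) = 0"
      using pn by (simp add: scaleR_diff_right mult.commute)
    then have yn: "?y = b *\<^sub>R n" using px by simp
    then have "dual_point \<omega> S (span {x}) = span {?y}"
      using n(3) y0 by (metis scaleR_eq_0_iff span_singleton_scaleR)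
    moreover have "a = ?m + ?y" "a' = ?m - ?y"
      by (simp_all only: midpoint_reflect) simp
    ultimately show "outer_rule \<omega> S (span {x}) Z Z'"
      using R a unfolding outer_rule_def midpoint_rule_def by metis
  next
    assume R: "outer_rule \<omega> S (span {x}) Z Z'"
    then obtain m y where my: "span {x} = span {m}" "dual_point \<omega> S (span {x}) = span {y}"
      "Z = span {m + y}" "Z' = span {m - y}" and ne: "dual_point \<omega> S (span {x}) \<noteq> span {x}"
      unfolding outer_rule_def by blast
    have y0: "y \<noteq> 0" using my n span_singleton_eq_nonzero by metis
    obtain k where "y = k *\<^sub>R n" using my n span_singleton_eqD by metis
    then have py: "\<omega> p y = 0" using pn by (simp add: scaleR_right)
    obtain k where "k \<noteq> 0" "m = k *\<^sub>R x" using my x0 span_singleton_eqD by metis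
    then have pm: "\<omega> p m \<noteq> 0" using px by (simp add: scaleR_right)
    have line: "span {m + y} \<subseteq> characteristic_line \<omega> S (span {x})"
      "span {m - y} \<subseteq> characteristic_line \<omega> S (span {x})"
      using span_subset_characteristic_line[of m y 1 1] span_subset_characteristic_line[of m y 1 "- 1"] my(1,2)
      by simp_all
    have "Z \<noteq> Z'"
    proof
      assume "Z = Z'"
      moreover have "m + y \<noteq> 0" using pm py by (metis add.right_neutral add_right zero_right)
      ultimately obtain k where k: "m - y = k *\<^sub>R (m + y)"
        using my span_singleton_eqD by metis
      then have "\<omega> p (m - y) = \<omega> p (k *\<^sub>R (m + y))" by simp
      then have "k = 1" using pm py by (simp add: diff_right add_right scaleR_right)
      with k have "m - y = m + y" by simp
      then show False using y0 diff_eq_add_imp_zero by blast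
    qed
    moreover have "affine_midpoint H (span {x}) Z Z'"
      unfolding affine_midpoint_def
      by (rule exI[of _ "m + y"], rule exI[of _ "m - y"])
        (use my pm py in \<open>simp add: H midpoint_add_diff add_right diff_right minus_right\<close>)
    ultimately show "midpoint_rule \<omega> H S (span {x}) Z Z'"
      unfolding midpoint_rule_def using q ne line my by blast
  qed
qed

text \<open>One pair of points \<open>x + u\<close> and \<open>x - u\<close> suffices. The outer
  rule writes it as \<open>m + y\<close> and \<open>m - y\<close> with \<open>y\<close> over the
  dual point, and comparison shows that \<open>y\<close> is at infinity like
  \<open>u\<close>.\<close>

lemma tangent_if_rules_agree:
  assumes x: "x \<in> lifts S" "x \<notin> H" and ne: "dual_point \<omega> S (span {x}) \<noteq> span {x}"
    and agree: "\<And>Z Z'. midpoint_rule \<omega> H S (span {x}) Z Z' \<Longrightarrow> outer_rule \<omega> S (span {x}) Z Z'"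
  shows "p \<in> tangent_hyperplane S (span {x})"
proof -
  obtain n where n: "n \<noteq> 0" "tangent_hyperplane S (span {x}) = {w. \<omega> n w = 0}"
    "dual_point \<omega> S (span {x}) = span {n}"
    using tangent_dual[OF x(1)] by metis
  have px: "\<omega> p x \<noteq> 0" using x H by simp
  then have x0: "x \<noteq> 0" by (auto simp: zero_right)
  \<comment> \<open>A lift of the point where the characteristic line meets
    \<open>H\<close>.\<close>
  define u where "u = \<omega> p x *\<^sub>R n - \<omega> p n *\<^sub>R x"
  have pu: "\<omega> p u = 0" by (simp add: u_def diff_right scaleR_right)
  have u0: "u \<noteq> 0"
  proof
    assume "u = 0"
    then have "\<omega> p x *\<^sub>R n = \<omega> p n *\<^sub>R x" by (simp add: u_def)
    then have "n = (\<omega> p n / \<omega> p x) *\<^sub>R x"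
      using px by (metis divide_inverse_commute scaleR_scaleR left_inverse scaleR_one)
    then show False using n ne by (metis scaleR_eq_0_iff span_singleton_scaleR)
  qed
  have pxu: "\<omega> p (x + u) = \<omega> p x" "\<omega> p (x - u) = \<omega> p x" using pu by (simp_all add: add_right diff_right)
  then have xu0: "x + u \<noteq> 0" "x - u \<noteq> 0" using px by (auto simp: zero_right)
  have "x + u = (1 - \<omega> p n) *\<^sub>R x + \<omega> p x *\<^sub>R n" "x - u = (1 + \<omega> p n) *\<^sub>R x + (- \<omega> p x) *\<^sub>R n"
    by (simp_all add: u_def algebra_simps)
  then have line: "span {x + u} \<subseteq> characteristic_line \<omega> S (span {x})"
      "span {x - u} \<subseteq> characteristic_line \<omega> S (span {x})"
    using span_subset_characteristic_line[OF n(3)] by metis+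
  have "span {x + u} \<noteq> span {x - u}"
  proof
    assume "span {x + u} = span {x - u}"
    then obtain k where k: "x + u = k *\<^sub>R (x - u)" using xu0 span_singleton_eqD by metis
    then have "\<omega> p (x + u) = \<omega> p (k *\<^sub>R (x - u))" by simp
    then have "k = 1" using px pxu by (simp add: scaleR_right)
    with k have "x - u = x + u" by simp
    then show False using u0 diff_eq_add_imp_zero by blast
  qed
  moreover have "affine_midpoint H (span {x}) (span {x + u}) (span {x - u})"
    unfolding affine_midpoint_def
    by (rule exI[of _ "x + u"], rule exI[of _ "x - u"])
      (use px pu in \<open>simp add: H midpoint_add_diff add_right diff_right minus_right\<close>)
  ultimately have "midpoint_rule \<omega> H S (span {x}) (span {x + u}) (span {x - u})"
    unfolding midpoint_rule_def using x ne line by (simp add: lifts_def)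
  from agree[OF this] obtain m y where my: "span {x} = span {m}" "span {n} = span {y}"
      "span {x + u} = span {m + y}" "span {x - u} = span {m - y}"
    unfolding outer_rule_def n(3) by blast
  obtain k where k: "m = k *\<^sub>R x" using my x0 span_singleton_eqD by metis
  obtain r where r: "m + y = r *\<^sub>R (x + u)" using my xu0 span_singleton_eqD by metis
  obtain s where s: "m - y = s *\<^sub>R (x - u)" using my xu0 span_singleton_eqD by metis
  \<comment> \<open>The sum of the two lifts is a multiple of \<open>x\<close>, which forces
    \<open>r = s\<close>; their difference is then a multiple of \<open>u\<close>.\<close>
  have "2 *\<^sub>R m = (m + y) + (m - y)" by (simp add: scaleR_2)
  also have "\<dots> = (r + s) *\<^sub>R x + (r - s) *\<^sub>R u" unfolding r s by (simp add: algebra_simps)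
  finally have sum: "(2 * k) *\<^sub>R x = (r + s) *\<^sub>R x + (r - s) *\<^sub>R u" by (simp add: k)
  then have "\<omega> p ((2 * k) *\<^sub>R x) = \<omega> p ((r + s) *\<^sub>R x + (r - s) *\<^sub>R u)" by (rule arg_cong)
  then have "2 * k = r + s" using px pu by (simp add: scaleR_right add_right)
  with sum have "(r - s) *\<^sub>R u = 0" by simp
  then have "r = s" using u0 by simp
  have "2 *\<^sub>R y = (m + y) - (m - y)" by (simp add: scaleR_2)
  also have "\<dots> = (r - s) *\<^sub>R x + (r + s) *\<^sub>R u" unfolding r s by (simp add: algebra_simps)
  finally have "2 *\<^sub>R y = (r - s) *\<^sub>R x + (r + s) *\<^sub>R u" .
  then have "\<omega> p (2 *\<^sub>R y) = 0" using pu by (simp add: \<open>r = s\<close> scaleR_right)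
  then have py: "\<omega> p y = 0" by (simp add: scaleR_right)
  have "y \<noteq> 0" using my n span_singleton_eq_nonzero by metis
  then obtain c where "n = c *\<^sub>R y" using my span_singleton_eqD by metis
  then have "\<omega> p n = 0" using py by (simp add: scaleR_right)
  then show ?thesis using n(2) skew[of p n] by simp
qed

end

section \<open>Reflections as maps\<close>

text \<open>\<open>x z\<close> is the lift of the base point at the level of \<open>z\<close>, so
  \<open>z - x z\<close> is at infinity and \<open>2 *\<^sub>R x z - z\<close> lifts the mirror
  image. Differentiability of the derivative \<open>X\<close> gives access to the exterior
  derivative of forms built from it.\<close>

locale midpoint_reflection = midpoint_table +
  fixes W :: "'a set" and x :: "'a \<Rightarrow> 'a" and X :: "'a \<Rightarrow> 'a \<Rightarrow> 'a"
  assumes W: "open W"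
    and X: "z \<in> W \<Longrightarrow> (x has_derivative X z) (at z)"
    and X2: "z \<in> W \<Longrightarrow> (\<lambda>z. X z w) differentiable (at z)"
    and x: "z \<in> W \<Longrightarrow> x z \<in> lifts S"
    and pz: "z \<in> W \<Longrightarrow> \<omega> p z \<noteq> 0"
    and px: "z \<in> W \<Longrightarrow> \<omega> p (x z) = \<omega> p z"
    and y0: "z \<in> W \<Longrightarrow> z - x z \<noteq> 0"
    and line: "z \<in> W \<Longrightarrow> z - x z \<in> characteristic_line \<omega> S (span {x z})"

context midpoint_table
begin

text \<open>The base point is the midpoint of \<open>z\<close> and a rescaled \<open>F z\<close>, so
  it inherits regularity from \<open>F\<close>. For the last claim,
  \<open>2 *\<^sub>R x z - z\<close> and \<open>F z\<close> lift the same point, and rescaling a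
  lift only multiplies the pulled back contact form by a nonvanishing function.\<close>

lemma reflection_lift:
  assumes R: "rule_map (midpoint_rule \<omega> H S) U \<phi>" and F: "smooth_lift W F \<phi>" and WU: "W \<subseteq> lifts U"
  obtains x X where "midpoint_reflection \<omega> p H S W x X"
    and "\<forall>z\<in>W. \<forall>q. midpoint_rule \<omega> H S q (span {z}) (\<phi> (span {z})) \<longrightarrow> q = span {x z}"
    and "\<forall>z\<in>W. \<exists>c. c \<noteq> 0 \<and> (\<forall>w. \<omega> (2 *\<^sub>R x z - z) (2 *\<^sub>R X z w - w)
            = c * \<omega> (F z) (frechet_derivative F (at z) w))"
proof -
  have smF: "smooth_on W F" and \<phi>: "\<And>z. z \<in> W \<Longrightarrow> \<phi> (span {z}) = span {F z}"
    using F by (auto simp: smooth_lift_def)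
  define F' where "F' = (\<lambda>z. frechet_derivative F (at z))"
  have F': "(F has_derivative F' z) (at z)" "(\<lambda>z. F' z w) differentiable (at z)" if "z \<in> W" for z w
    unfolding F'_def
    using smooth_on_has_derivative[OF smF that] smooth_on_differentiable_derivative[OF smF that] by auto
  have Fd: "F differentiable (at z)" if "z \<in> W" for z
    using F'(1)[OF that] by (rule differentiableI)
  \<comment> \<open>\<open>c z\<close> brings \<open>F z\<close> to the level of \<open>z\<close>,
    and \<open>c'\<close> is its derivative by the quotient rule.\<close>
  define c where "c = (\<lambda>z. \<omega> p z / \<omega> p (F z))"
  define c' where "c' = (\<lambda>z w. \<omega> p w / \<omega> p (F z) - \<omega> p z * \<omega> p (F' z w) / (\<omega> p (F z) * \<omega> p (F z)))"
  define x where "x = (\<lambda>z. (1 / 2) *\<^sub>R (z + c z *\<^sub>R F z))"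
  define X where "X = (\<lambda>z w. (1 / 2) *\<^sub>R (w + (c' z w *\<^sub>R F z + c z *\<^sub>R F' z w)))"
  have rule: "\<exists>q. midpoint_rule \<omega> H S q (span {z}) (span {F z})" if "z \<in> W" for z
  proof -
    have "span {z} \<in> U" using WU that by (auto simp: lifts_def)
    then show ?thesis using R \<phi>[OF that] unfolding rule_map_def by metis
  qed
  have props: "\<omega> p z \<noteq> 0" "\<omega> p (F z) \<noteq> 0" "x z \<in> lifts S" "\<omega> p (x z) = \<omega> p z"
     "z - x z \<in> characteristic_line \<omega> S (span {x z})" "z - x z \<noteq> 0"
    if "z \<in> W" for z
  proof -
    obtain q where q: "midpoint_rule \<omega> H S q (span {z}) (span {F z})" using rule[OF \<open>z \<in> W\<close>] ..
    note * = midpoint_rule_normal_form[OF q]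
    show "\<omega> p z \<noteq> 0" "\<omega> p (F z) \<noteq> 0" "x z \<in> lifts S" "\<omega> p (x z) = \<omega> p z"
     "z - x z \<in> characteristic_line \<omega> S (span {x z})" "z - x z \<noteq> 0"
      using *(1,2,4-7) unfolding x_def c_def by simp_all
  qed
  have c0: "c z \<noteq> 0" if "z \<in> W" for z using props[OF that] by (simp add: c_def)
  have cd: "(c has_derivative c' z) (at z)" if "z \<in> W" for z
  proof -
    have "((\<lambda>z. \<omega> p (F z)) has_derivative (\<lambda>w. \<omega> p (F' z w))) (at z)"
      using bounded_linear.has_derivative[OF bounded_linear_right F'(1)[OF that]] .
    from has_derivative_divide[OF bounded_linear_imp_has_derivative[OF bounded_linear_right] this props(2)[OF that]]
    show ?thesis
      unfolding c_def c'_def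
      by (rule has_derivative_eq_rhs) (simp add: fun_eq_iff divide_inverse mult_ac)
  qed
  have derivs: "(x has_derivative X z) (at z)" "(\<lambda>z. X z w) differentiable (at z)" if z: "z \<in> W" for z w
  proof -
    show "(x has_derivative X z) (at z)"
      unfolding x_def X_def
      by (intro has_derivative_scaleR_right has_derivative_add has_derivative_ident
          has_derivative_scaleR[OF cd[OF z] F'(1)[OF z], THEN has_derivative_eq_rhs])
        (simp add: fun_eq_iff add.commute)
    show "(\<lambda>z. X z w) differentiable (at z)"
    proof -
      have "c differentiable (at z)" using cd[OF z] by (rule differentiableI)
      moreover have "(\<lambda>z. c' z w) differentiable (at z)"
        unfolding c'_def using props(2)[OF z]
        by (intro differentiable_diff differentiable_divide differentiable_mult differentiable_right
            Fd[OF z] F'(2)[OF z] differentiable_const differentiable_ident) simp_all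
      ultimately show ?thesis
        unfolding X_def
        by (intro differentiable_scaleR differentiable_add Fd[OF z] F'(2)[OF z] differentiable_const)
    qed
  qed
  show thesis
  proof
    show "midpoint_reflection \<omega> p H S W x X"
      by unfold_locales (use smF derivs props in \<open>auto simp: smooth_on_def\<close>)
  next
    show "\<forall>z\<in>W. \<forall>q. midpoint_rule \<omega> H S q (span {z}) (\<phi> (span {z})) \<longrightarrow> q = span {x z}"
      using midpoint_rule_normal_form(3) \<phi> by (simp add: x_def c_def)
  next
    show "\<forall>z\<in>W. \<exists>k. k \<noteq> 0 \<and> (\<forall>w. \<omega> (2 *\<^sub>R x z - z) (2 *\<^sub>R X z w - w)
            = k * \<omega> (F z) (frechet_derivative F (at z) w))"
    proof (intro ballI exI conjI allI)
      fix z assume z: "z \<in> W"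
      show "c z * c z \<noteq> 0" using c0[OF z] by simp
      fix w
      \<comment> \<open>The term with \<open>c'\<close> is parallel to \<open>F z\<close>, hence
        killed by \<open>\<omega>\<close>.\<close>
      have "2 *\<^sub>R x z - z = c z *\<^sub>R F z" "2 *\<^sub>R X z w - w = c' z w *\<^sub>R F z + c z *\<^sub>R F' z w"
        by (simp_all add: x_def X_def)
      then show "\<omega> (2 *\<^sub>R x z - z) (2 *\<^sub>R X z w - w)
            = c z * c z * \<omega> (F z) (frechet_derivative F (at z) w)"
        by (simp add: scaleR_left scaleR_right add_right F'_def)
    qed
  qed
qed

text \<open>The line is spanned by \<open>x\<close> and \<open>n\<close>, which are orthogonal
  because \<open>x\<close> is tangent to the cone.\<close>

lemma isotropic_line:
  assumes "x \<in> lifts S" and "y \<in> characteristic_line \<omega> S (span {x})"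
  shows "\<omega> x y = 0"
proof -
  obtain n where n: "dual_point \<omega> S (span {x}) = span {n}" "\<omega> n x = 0"
    using tangent_dual[OF assms(1)] by metis
  obtain a b where "y = a *\<^sub>R x + b *\<^sub>R n"
    using characteristic_lineE[OF assms n(1)] by metis
  then show ?thesis using n(2) skew[of x n] by (simp add: add_right scaleR_right)
qed

end

context midpoint_reflection
begin

text \<open>Differentiating the isotropy relation \<open>\<omega> (x z) z = 0\<close> gives
  \<open>\<omega> (x z) w = \<omega> z (X z w)\<close>, by which the mixed terms combine to
  \<open>- 4 * \<omega> z (X z w)\<close>.\<close>

lemma reflected_contact_form:
  assumes z: "z \<in> W"
  shows "\<omega> (2 *\<^sub>R x z - z) (2 *\<^sub>R X z w - w) = \<omega> z w - 4 * \<omega> (z - x z) (X z w)"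
proof -
  have xz: "\<omega> (x z) z = 0" if "z \<in> W" for z
    using isotropic_line[OF x[OF that] line[OF that]] by (simp add: diff_right)
  have "((\<lambda>z. \<omega> (x z) z) has_derivative (\<lambda>w. \<omega> (x z) w + \<omega> (X z w) z)) (at z)"
    by (rule FDERIV[OF X[OF z] has_derivative_ident])
  moreover have "((\<lambda>z. \<omega> (x z) z) has_derivative (\<lambda>_. 0)) (at z)"
    by (rule has_derivative_transform_within_open[OF has_derivative_const W z]) (simp add: xz)
  ultimately have "(\<lambda>w. \<omega> (x z) w + \<omega> (X z w) z) = (\<lambda>_. 0)"
    by (rule has_derivative_unique)
  from fun_cong[OF this, of w] have "\<omega> (x z) w = \<omega> z (X z w)" using skew[of z "X z w"] by simp
  then show ?thesis
    by (simp add: diff_left diff_right scaleR_left scaleR_right)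
qed

text \<open>In \<open>z = x z + y\<close> the direction \<open>y\<close> depends, up to a factor, on the base point only.  So if the
  base point is stationary, then \<open>z\<close> moves along \<open>y\<close>; and the base point is stationary in some
  direction because it stays on a hypersurface.\<close>

lemma base_point_stationary:
  assumes z: "z \<in> W"
  shows "X z (z - x z) = 0" and "\<And>v. X z v = 0 \<Longrightarrow> v \<in> span {z - x z}"
proof -
  define y where "y = (\<lambda>z. z - x z)"
  have lin: "linear (X z)" using X[OF z] has_derivative_linear by blast
  obtain V n where V: "open V" "x z \<in> V"
    and nd: "\<forall>x\<in>V. n differentiable (at x)"
    and n: "\<forall>x\<in>V \<inter> lifts S. n x \<noteq> 0 \<and> tangent_hyperplane S (span {x}) = {w. \<omega> (n x) w = 0} \<and>
       dual_point \<omega> S (span {x}) = span {n x} \<and> \<omega> (n x) x = 0"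
    using table_gradient[OF S x[OF z]] .
  have n0: "n (x z) \<noteq> 0" and tan: "tangent_hyperplane S (span {x z}) = {w. \<omega> (n (x z)) w = 0}"
    using n V(2) x[OF z] by blast+
  have dual: "dual_point \<omega> S (span {x}) = span {n x}" if "x \<in> V" "x \<in> lifts S" for x
    using n that by blast
  \<comment> \<open>The direction at infinity of the characteristic line, as a differentiable
    function of the base point.\<close>
  define u where "u = (\<lambda>x. \<omega> p x *\<^sub>R n x - \<omega> p (n x) *\<^sub>R x)"
  have par: "\<exists>b. \<omega> p z *\<^sub>R y z = b *\<^sub>R u (x z)" if "z \<in> W" "x z \<in> V" for z
    using parallel_direction_at_infinity[OF x[OF that(1)] line[OF that(1)] _ dual[OF that(2) x[OF that(1)]]]
      px[OF that(1)] by (simp add: u_def y_def diff_right)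
  obtain b where b: "\<omega> p z *\<^sub>R y z = b *\<^sub>R u (x z)" using par[OF z V(2)] by blast
  then have b0: "b \<noteq> 0" "u (x z) \<noteq> 0" using y0[OF z] pz[OF z] by (auto simp: y_def)
  \<comment> \<open>Pairing with \<open>w\<close> eliminates the unknown factor between
    \<open>y\<close> and \<open>u\<close>: the relation \<open>cross\<close> can be differentiated
    without regularity of that factor.\<close>
  obtain w where w: "\<omega> (u (x z)) w \<noteq> 0" using nondegenerate b0(2) by blast
  have "u differentiable (at (x z))"
    unfolding u_def
    by (intro differentiable_diff differentiable_scaleR differentiable_right bspec[OF nd V(2)] differentiable_ident)
  then obtain u' where u': "(u has_derivative u') (at (x z))" by (auto simp: differentiable_def)
  have u'0: "u' 0 = 0" using linear_0[OF has_derivative_linear[OF u']] .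
  have dux: "((\<lambda>z. u (x z)) has_derivative (\<lambda>v. u' (X z v))) (at z)"
    by (rule has_derivative_compose[OF X[OF z] u'])
  have dy: "(y has_derivative (\<lambda>v. v - X z v)) (at z)"
    unfolding y_def by (intro has_derivative_diff has_derivative_ident X z)
  obtain V' where V': "open V'" "z \<in> V'" "V' \<subseteq> W" "\<And>z. z \<in> V' \<Longrightarrow> x z \<in> V"
  proof -
    have "continuous_on W x"
      using X has_derivative_continuous continuous_at_imp_continuous_on by blast
    then have "open (x -` V \<inter> W)" using V(1) W continuous_on_open_vimage by blast
    then show thesis using that[of "x -` V \<inter> W"] z V by auto
  qed
  have cross: "\<omega> (u (x z)) w *\<^sub>R y z = \<omega> (y z) w *\<^sub>R u (x z)" if "z \<in> V'" for z
  proof -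
    obtain b where b: "\<omega> p z *\<^sub>R y z = b *\<^sub>R u (x z)" using par[of z] V' \<open>z \<in> V'\<close> by blast
    have "\<omega> p z \<noteq> 0" using pz V' that by blast
    then have "y z = (b / \<omega> p z) *\<^sub>R u (x z)"
      using b by (simp add: eq_vector_fraction_iff)
    then show ?thesis by (simp add: scaleR_left)
  qed
  show sub: "v \<in> span {z - x z}" if v: "X z v = 0" for v
  proof -
    have D1: "((\<lambda>z. \<omega> (u (x z)) w *\<^sub>R y z) has_derivative
        (\<lambda>v. \<omega> (u (x z)) w *\<^sub>R (v - X z v) + \<omega> (u' (X z v)) w *\<^sub>R y z)) (at z)"
      by (intro has_derivative_scaleR dy bounded_linear.has_derivative[OF bounded_linear_left] dux)
    have D2: "((\<lambda>z. \<omega> (y z) w *\<^sub>R u (x z)) has_derivative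
        (\<lambda>v. \<omega> (y z) w *\<^sub>R u' (X z v) + \<omega> (v - X z v) w *\<^sub>R u (x z))) (at z)"
      by (intro has_derivative_scaleR dux bounded_linear.has_derivative[OF bounded_linear_left] dy)
    have "((\<lambda>z. \<omega> (u (x z)) w *\<^sub>R y z) has_derivative
        (\<lambda>v. \<omega> (y z) w *\<^sub>R u' (X z v) + \<omega> (v - X z v) w *\<^sub>R u (x z))) (at z)"
      by (rule has_derivative_transform_within_open[OF D2 V'(1,2)]) (simp add: cross)
    \<comment> \<open>In a direction with \<open>X z v = 0\<close> all terms through the base point
      drop out, and \<open>y\<close> moves with velocity \<open>v\<close>.\<close>
    from fun_cong[OF has_derivative_unique[OF D1 this], of v]
    have "\<omega> (u (x z)) w *\<^sub>R v = \<omega> v w *\<^sub>R u (x z)"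
      using v u'0 by (simp add: zero_left)
    then have "v = (\<omega> v w / \<omega> (u (x z)) w) *\<^sub>R u (x z)"
      using w by (simp add: eq_vector_fraction_iff)
    moreover have "u (x z) = (\<omega> p z / b) *\<^sub>R y z"
      using b b0 by (simp add: eq_vector_fraction_iff)
    ultimately have "v \<in> span {y z}" by (auto simp: span_singleton)
    then show ?thesis by (simp add: y_def)
  qed
  have "\<not> surj (X z)"
  proof
    assume sur: "surj (X z)"
    have "\<omega> (n (x z)) t = 0" for t
    proof -
      obtain v where "t = X z v" using sur by (metis surjD)
      moreover have "X z v \<in> tangent_hyperplane S (span {x z})"
        by (rule tangent_hyperplaneI[OF X[OF z] W z]) (rule x)
      ultimately show ?thesis using tan by simp
    qed
    then show False using nondegenerate n0 by blast
  qed
  \<comment> \<open>The kernel of \<open>X z\<close> is nonzero and lies on the line of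
    \<open>z - x z\<close>, so it is that line.\<close>
  then have "\<not> inj (X z)" using linear_injective_imp_surjective[OF lin] by blast
  then obtain v where v: "X z v = 0" "v \<noteq> 0" using linear_injective_0[OF lin] by blast
  then obtain k where k: "v = k *\<^sub>R (z - x z)" using sub by (auto simp: span_singleton)
  then have "k \<noteq> 0" "k *\<^sub>R X z (z - x z) = 0" using v linear_cmul[OF lin] by auto
  then show "X z (z - x z) = 0" by simp
qed

end

section \<open>Equivalence of the contact, coincidence and cone conditions\<close>

context midpoint_table
begin

text \<open>As the dual point is at infinity, \<open>z - x z\<close> is a multiple of
  \<open>n\<close> and thus orthogonal to the tangent hyperplane, where \<open>X z\<close> takes its
  values. The correction term in \<open>reflected_contact_form\<close> vanishes.\<close>

lemma generates_if_cone:
  assumes cone: "\<And>x. x \<in> lifts S \<Longrightarrow> p \<in> tangent_hyperplane S (span {x})"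
  shows "generates_contact_transformation \<omega> (midpoint_rule \<omega> H S)"
  unfolding generates_contact_transformation_def preserves_contact_def
proof (intro allI impI ballI)
  fix U \<phi> W F z w
  assume R: "rule_map (midpoint_rule \<omega> H S) U \<phi>" and WF: "W \<subseteq> lifts U \<and> smooth_lift W F \<phi>" and z: "z \<in> W"
  have Fz: "\<phi> (span {z}) = span {F z}"
    using WF z by (auto simp: smooth_lift_def)
  obtain x X where refl: "midpoint_reflection \<omega> p H S W x X"
    and "\<forall>z\<in>W. \<forall>q. midpoint_rule \<omega> H S q (span {z}) (\<phi> (span {z})) \<longrightarrow> q = span {x z}"
    and c: "\<forall>z\<in>W. \<exists>c. c \<noteq> 0 \<and> (\<forall>w. \<omega> (2 *\<^sub>R x z - z) (2 *\<^sub>R X z w - w)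
            = c * \<omega> (F z) (frechet_derivative F (at z) w))"
    using reflection_lift[OF R conjunct2[OF WF] conjunct1[OF WF]] .
  interpret midpoint_reflection \<omega> p H S W x X by (rule refl)
  obtain n where n: "tangent_hyperplane S (span {x z}) = {w. \<omega> n w = 0}"
    "dual_point \<omega> S (span {x z}) = span {n}"
    using tangent_dual[OF x[OF z]] by metis
  have "\<omega> p n = 0" using cone[OF x[OF z]] n(1) skew[of p n] by simp
  moreover obtain b where "\<omega> p (x z) *\<^sub>R (z - x z) = b *\<^sub>R (\<omega> p (x z) *\<^sub>R n - \<omega> p n *\<^sub>R x z)"
    using parallel_direction_at_infinity[OF x[OF z] line[OF z] _ n(2)] px[OF z] by (auto simp: diff_right)
  ultimately have "\<omega> p z *\<^sub>R (z - x z) = \<omega> p z *\<^sub>R (b *\<^sub>R n)" by (simp add: px[OF z] mult.commute)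
  then have y: "z - x z = b *\<^sub>R n" by (rule scaleR_left_imp_eq[OF pz[OF z]])
  have "X z w \<in> tangent_hyperplane S (span {x z})"
    by (rule tangent_hyperplaneI[OF X[OF z] W z]) (rule x)
  then have "\<omega> (z - x z) (X z w) = 0" using n(1) by (simp add: y scaleR_left)
  then have "\<omega> (2 *\<^sub>R x z - z) (2 *\<^sub>R X z w - w) = \<omega> z w"
    using reflected_contact_form[OF z] by simp
  then have "\<omega> z w = 0 \<longleftrightarrow> \<omega> (F z) (frechet_derivative F (at z) w) = 0"
    using bspec[OF c z] by auto
  then show "w \<in> contact_hyperplane \<omega> (span {z}) \<longleftrightarrow>
      frechet_derivative F (at z) w \<in> contact_hyperplane \<omega> (\<phi> (span {z}))"
    by (simp add: Fz contact_hyperplane_span)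
qed

text \<open>If \<open>p\<close> were not tangent, \<open>contact_form_not_basic\<close> would apply
  and make the direction \<open>y\<close>, which is at infinity, parallel to \<open>z\<close>, which
  is in the chart.\<close>

lemma tangent_if_generates:
  assumes gen: "generates_contact_transformation \<omega> (midpoint_rule \<omega> H S)"
    and q: "q \<in> nondegenerate_points (midpoint_rule \<omega> H S)"
  shows "p \<in> tangent_hyperplane S q"
proof (rule ccontr)
  assume np: "p \<notin> tangent_hyperplane S q"
  obtain U \<phi> Z where R: "rule_map (midpoint_rule \<omega> H S) U \<phi>" and Z: "Z \<in> U"
    and qZ: "midpoint_rule \<omega> H S q Z (\<phi> Z)"
    using q by (auto simp: nondegenerate_points_def)
  have diffeo: "openin proj_topology U" "proj_smooth_on U \<phi>"
    using R by (auto simp: rule_map_def proj_diffeo_on_def)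
  then have "Z \<in> proj_points" using Z by (auto simp: openin_proj_topology)
  then obtain z where z: "Z = span {z}" by (elim proj_pointE)
  then have "z \<in> lifts U" using Z by (simp add: lifts_def)
  then obtain W F where WF: "z \<in> W" "W \<subseteq> lifts U" "smooth_lift W F \<phi>"
    using diffeo(2) unfolding proj_smooth_on_def by blast
  note zW = WF(1)
  have Fz: "\<And>z. z \<in> W \<Longrightarrow> \<phi> (span {z}) = span {F z}"
    using WF by (auto simp: smooth_lift_def)
  obtain x X where refl: "midpoint_reflection \<omega> p H S W x X"
    and base: "\<forall>z\<in>W. \<forall>q. midpoint_rule \<omega> H S q (span {z}) (\<phi> (span {z})) \<longrightarrow> q = span {x z}"
    and c: "\<forall>z\<in>W. \<exists>c. c \<noteq> 0 \<and> (\<forall>w. \<omega> (2 *\<^sub>R x z - z) (2 *\<^sub>R X z w - w)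
            = c * \<omega> (F z) (frechet_derivative F (at z) w))"
    using reflection_lift[OF R WF(3,2)] .
  interpret midpoint_reflection \<omega> p H S W x X by (rule refl)
  have q: "q = span {x z}" using bspec[OF base zW] qZ z by simp
  define y where "y = z - x z"
  have py: "\<omega> p y = 0" using px[OF zW] by (simp add: y_def diff_right)
  have yn0: "y \<noteq> 0" using y0[OF zW] by (simp add: y_def)
  have Xy: "X z y = 0" and Xker: "\<And>v. X z v = 0 \<Longrightarrow> v \<in> span {y}"
    using base_point_stationary[OF zW] by (simp_all add: y_def)
  \<comment> \<open>Where \<open>\<omega> z\<close> vanishes, so does the reflected form, since
    contact hyperplanes are preserved; hence so does the difference of the two.\<close>
  have ker: "\<omega> (z - x z) (X z w) = 0" if "z \<in> W" "\<omega> z w = 0" for z w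
  proof -
    have "w \<in> contact_hyperplane \<omega> (span {z}) \<longleftrightarrow>
        frechet_derivative F (at z) w \<in> contact_hyperplane \<omega> (\<phi> (span {z}))"
      using gen R WF that(1) unfolding generates_contact_transformation_def preserves_contact_def by blast
    then have "\<omega> (F z) (frechet_derivative F (at z) w) = 0"
      using that by (simp add: Fz contact_hyperplane_span)
    then have "\<omega> (2 *\<^sub>R x z - z) (2 *\<^sub>R X z w - w) = 0" using bspec[OF c that(1)] by auto
    then show ?thesis using reflected_contact_form[OF that(1)] that(2) by simp
  qed
  obtain n where n: "n \<noteq> 0" "tangent_hyperplane S q = {w. \<omega> n w = 0}" "dual_point \<omega> S q = span {n}"
    unfolding q using tangent_dual[OF x[OF zW]] by metis
  have XT: "X z w \<in> tangent_hyperplane S q" for w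
    unfolding q by (rule tangent_hyperplaneI[OF X[OF zW] W zW]) (rule x)
  \<comment> \<open>Otherwise \<open>y\<close> annihilates the image of \<open>X z\<close>. As
    \<open>X z\<close> is injective on the complement \<open>P\<close> of \<open>y\<close>, this
    image is the whole tangent hyperplane, so \<open>y\<close> is parallel to \<open>n\<close> and
    the dual point is at infinity, contrary to \<open>np\<close>.\<close>
  obtain w where w: "\<omega> y (X z w) \<noteq> 0"
  proof (rule ccontr)
    assume "\<not> thesis"
    then have 0: "\<omega> y (X z w) = 0" for w using that by blast
    have lin: "linear (X z)" using X[OF zW] has_derivative_linear by blast
    have lin\<omega>: "linear (\<omega> n)" using bounded_linear_right bounded_linear.linear by blast
    define T where "T = {w. \<omega> n w = 0}"
    define P where "P = {v. y \<bullet> v = 0}"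
    have subT: "subspace T" unfolding T_def using linear_subspace_kernel[OF lin\<omega>] .
    have subP: "subspace P" unfolding P_def by (rule subspace_hyperplane)
    have "inj_on (X z) (span P)"
    proof (rule inj_onI)
      fix a b assume ab: "a \<in> span P" "b \<in> span P" "X z a = X z b"
      have P: "a - b \<in> P" using ab(1,2) subP by (metis span_eq_iff subspace_diff)
      have "X z (a - b) = 0" using ab(3) linear_diff[OF lin] by simp
      then obtain k where k: "a - b = k *\<^sub>R y" using Xker by (auto simp: span_singleton)
      then have "k * (y \<bullet> y) = 0" using P by (simp add: P_def)
      then show "a = b" using k yn0 by simp
    qed
    then have "dim (X z ` P) = dim P" by (rule dim_image_eq[OF lin])
    also have "dim P = DIM('a) - 1" unfolding P_def by (rule dim_hyperplane[OF yn0])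
    finally have dimX: "dim (X z ` P) = DIM('a) - 1" .
    have "T \<noteq> UNIV" using n(1) nondegenerate unfolding T_def by blast
    then have "dim T < DIM('a)"
      using dim_eq_full subT span_eq_iff dim_subset_UNIV le_neq_implies_less by metis
    moreover have sub: "X z ` P \<subseteq> T" using XT n(2) by (auto simp: T_def)
    ultimately have "X z ` P = T"
      using subspace_dim_equal[OF linear_subspace_image[OF lin subP] subT] dimX by simp
    then have "t \<in> X z ` P" if "\<omega> n t = 0" for t using that by (simp add: T_def)
    then have "\<omega> y t = 0" if "\<omega> n t = 0" for t using that 0 by auto
    then have "y \<in> span {n}"
      unfolding symp_orth_kernel[OF n(1), symmetric] by (simp add: symp_orth_def)
    then obtain k where "y = k *\<^sub>R n" by (auto simp: span_singleton)
    then have "\<omega> p n = 0" using py yn0 by (simp add: scaleR_right)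
    then show False using np n(2) skew[of p n] by simp
  qed
  have zy: "\<omega> z y = 0"
    using isotropic_line[OF x[OF zW] line[OF zW]] skew[of z "x z"] by (simp add: y_def diff_right)
  have "y \<in> span {z}"
    by (rule contact_form_not_basic[OF W zW X X2[OF zW] ker y_def Xy zy w])
  then obtain k where "y = k *\<^sub>R z" by (auto simp: span_singleton)
  then show False using py yn0 pz[OF zW] by (simp add: scaleR_right)
qed

text \<open>Non-tangency is an open condition. If it held at \<open>x\<close>, there would be no
  nondegenerate base points nearby, so by density the table would lie in \<open>H\<close> near
  \<open>x\<close>. Its tangent hyperplane there would then be \<open>H\<close>, which contains its
  own contact point.\<close>

lemma cone_if_tangent_nondegenerate:
  assumes gen: "generically_nondegenerate \<omega> H S"
    and tan: "\<And>q. q \<in> nondegenerate_points (midpoint_rule \<omega> H S) \<Longrightarrow> p \<in> tangent_hyperplane S q"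
    and x: "x \<in> lifts S"
  shows "p \<in> tangent_hyperplane S (span {x})"
proof (rule ccontr)
  assume np: "p \<notin> tangent_hyperplane S (span {x})"
  obtain W n where W: "open W" "x \<in> W"
    and nd: "\<forall>x\<in>W. n differentiable (at x)"
    and n: "\<forall>x\<in>W \<inter> lifts S. n x \<noteq> 0 \<and> tangent_hyperplane S (span {x}) = {w. \<omega> (n x) w = 0} \<and>
       dual_point \<omega> S (span {x}) = span {n x} \<and> \<omega> (n x) x = 0"
    using table_gradient[OF S x] .
  have n0: "n x \<noteq> 0" using n W(2) x by blast
  have T: "tangent_hyperplane S (span {x}) = {w. \<omega> (n x) w = 0}" if "x \<in> W" "x \<in> lifts S" for x
    using n that by blast
  define G where "G = (\<lambda>x. \<omega> p (n x)) -` (- {0}) \<inter> W"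
  have "continuous_on W (\<lambda>x. \<omega> p (n x))"
    using differentiable_right[OF bspec[OF nd]] differentiable_imp_continuous_within continuous_at_imp_continuous_on by blast
  then have opG: "open G"
    unfolding G_def using W(1) continuous_on_open_vimage open_Compl closed_singleton by blast
  have G: "x \<in> W" "p \<notin> tangent_hyperplane S (span {x})" if "x \<in> G" "x \<in> lifts S" for x
    using that T[of x] skew[of "n x" p] by (auto simp: G_def)
  have xG: "x \<in> G" using W(2) np T[OF W(2) x] skew[of p "n x"] by (auto simp: G_def)
  have inH: "v \<in> H" if v: "v \<in> G" "v \<in> lifts S" for v
  proof (rule ccontr)
    assume "v \<notin> H"
    then have "span {v} \<in> affine_part H S"
      using v span_base[of v "{v}"] by (auto simp: affine_part_def lifts_def)
    then have cl: "span {v} \<in> proj_topology closure_of nondegenerate_points (midpoint_rule \<omega> H S)"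
      using gen unfolding generically_nondegenerate_def by blast
    \<comment> \<open>The projective image of \<open>G\<close>; it is open because the cone over it
      is the union of the dilates of \<open>G - {0}\<close>.\<close>
    define O' where "O' = {span {u} |u. u \<in> G \<and> u \<noteq> 0}"
    have "lifts O' = (\<Union>k\<in>-{0}. (\<lambda>u. k *\<^sub>R u) ` (G - {0}))"
    proof (intro equalityI subsetI)
      fix a assume "a \<in> lifts O'"
      then obtain u where u: "span {a} = span {u}" "u \<in> G" "u \<noteq> 0" by (auto simp: lifts_def O'_def)
      then obtain k where "k \<noteq> 0" "a = k *\<^sub>R u" using span_singleton_eqD[OF u(1,3)] by metis
      then show "a \<in> (\<Union>k\<in>-{0}. (\<lambda>u. k *\<^sub>R u) ` (G - {0}))" using u by auto
    next
      fix a assume "a \<in> (\<Union>k\<in>-{0}. (\<lambda>u. k *\<^sub>R u) ` (G - {0}))"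
      then obtain k u where "k \<noteq> 0" "u \<in> G" "u \<noteq> 0" "a = k *\<^sub>R u" by auto
      then show "a \<in> lifts O'" by (auto simp: lifts_def O'_def span_singleton_scaleR)
    qed
    moreover have "open (\<Union>k\<in>-{0}. (\<lambda>u::'a. k *\<^sub>R u) ` (G - {0}))"
      using opG by (intro open_UN ballI open_scaling open_Diff) auto
    moreover have "O' \<subseteq> proj_points"
      by (auto simp: O'_def proj_points_def dim_insert)
    ultimately have "openin proj_topology O'" by (simp add: openin_proj_topology)
    moreover have "v \<noteq> 0"
      using v S proj_points_nonzero by (auto simp: lifts_def table_def)
    then have "span {v} \<in> O'" using v by (auto simp: O'_def)
    ultimately obtain q where q: "q \<in> nondegenerate_points (midpoint_rule \<omega> H S)" "q \<in> O'"
      using cl unfolding in_closure_of by blast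
    then obtain u where u: "q = span {u}" "u \<in> G" by (auto simp: O'_def)
    have "q \<in> S" using q(1) by (auto simp: nondegenerate_points_def midpoint_rule_def)
    then have "u \<in> lifts S" using u by (simp add: lifts_def)
    then show False using G[OF u(2)] tan[OF q(1)] u by simp
  qed
  \<comment> \<open>A curve in the cone starting over \<open>x\<close> stays, after rescaling, in
    \<open>G\<close> and hence in \<open>H\<close>.\<close>
  have "tangent_hyperplane S (span {x}) \<subseteq> H"
  proof
    fix w assume "w \<in> tangent_hyperplane S (span {x})"
    then obtain \<gamma> where g0: "span {\<gamma> 0} = span {x}" and g': "(\<gamma> has_vector_derivative w) (at 0)"
      and ev: "\<forall>\<^sub>F s in nhds 0. \<gamma> s \<in> lifts S"
      unfolding tangent_hyperplane_def by auto
    have x0: "x \<noteq> 0" using x S proj_points_nonzero by (auto simp: lifts_def table_def)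
    obtain k where k: "k \<noteq> 0" "\<gamma> 0 = k *\<^sub>R x" using span_singleton_eqD[OF g0 x0] by metis
    have "(\<gamma> \<longlongrightarrow> \<gamma> 0) (nhds 0)"
      using has_vector_derivative_continuous[OF g'] by (simp add: continuous_at tendsto_at_iff_tendsto_nhds)
    then have "((\<lambda>s. (1 / k) *\<^sub>R \<gamma> s) \<longlongrightarrow> (1 / k) *\<^sub>R \<gamma> 0) (nhds 0)"
      by (rule tendsto_scaleR[OF tendsto_const])
    moreover have "(1 / k) *\<^sub>R \<gamma> 0 \<in> G" using xG k by simp
    ultimately have "\<forall>\<^sub>F s in nhds 0. (1 / k) *\<^sub>R \<gamma> s \<in> G"
      using opG topological_tendstoD by blast
    with ev have "\<forall>\<^sub>F s in nhds 0. \<omega> p (\<gamma> s) = 0"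
    proof eventually_elim
      case (elim s)
      then have "(1 / k) *\<^sub>R \<gamma> s \<in> H" using k by (intro inH) (simp_all add: lifts_scaleR_iff)
      then show ?case using k by (simp add: H scaleR_right)
    qed
    then have zero: "((\<lambda>s. \<omega> p (\<gamma> s)) has_derivative (\<lambda>_. 0)) (at 0)"
      by (smt (verit, best) eventually_nhds has_derivative_const has_derivative_transform_within_open)
    have "((\<lambda>s. \<omega> p (\<gamma> s)) has_derivative (\<lambda>s. \<omega> p (s *\<^sub>R w))) (at 0)"
      by (rule bounded_linear.has_derivative[OF bounded_linear_right g'[unfolded has_vector_derivative_def]])
    from has_derivative_unique[OF this zero] have "(\<lambda>s. \<omega> p (s *\<^sub>R w)) = (\<lambda>_. 0)" .
    from fun_cong[OF this, of 1] show "w \<in> H" by (simp add: H)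
  qed
  then have "p \<in> symp_orth \<omega> {w. \<omega> (n x) w = 0}"
    unfolding T[OF W(2) x] symp_orth_def H by blast
  then have "p \<in> span {n x}" by (simp only: symp_orth_kernel[OF n0])
  then obtain k where "p = k *\<^sub>R n x" by (auto simp: span_singleton)
  then have "\<omega> (n x) p = 0" by (simp add: scaleR_right)
  then show False using np T[OF W(2) x] by blast
qed

lemma nondegenerate_point_affine:
  assumes "q \<in> nondegenerate_points (midpoint_rule \<omega> H S)"
  obtains x where "q = span {x}" "x \<in> lifts S" "x \<notin> H" "dual_point \<omega> S q \<noteq> q"
proof -
  obtain Z Z' where R: "midpoint_rule \<omega> H S q Z Z'"
    using assms by (auto simp: nondegenerate_points_def)
  then obtain z z' where z: "z \<notin> H" "z' - z \<in> H" "Z = span {z}" "Z' = span {z'}"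
    unfolding midpoint_rule_def affine_midpoint_def by blast
  note nf = midpoint_rule_normal_form[OF R[unfolded z(3,4)]]
  show thesis
    by (rule that[OF nf(3,4)]) (use nf(1,3,5,8) in \<open>simp_all add: H\<close>)
qed

text \<open>The contact condition and the coincidence of rules each give tangency of
  \<open>p\<close> at nondegenerate base points; density spreads it over the whole table, including
  points at infinity. The implications from the cone condition are pointwise.\<close>

lemma contact_coincide_cone:
  assumes gen: "generically_nondegenerate \<omega> H S"
  shows "(generates_contact_transformation \<omega> (midpoint_rule \<omega> H S) \<longleftrightarrow>
            rules_coincide H S (midpoint_rule \<omega> H S) (outer_rule \<omega> S)) \<and>
         (rules_coincide H S (midpoint_rule \<omega> H S) (outer_rule \<omega> S) \<longleftrightarrow>
            generalized_cone S (contact_point \<omega> H))"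
proof -
  let ?contact = "generates_contact_transformation \<omega> (midpoint_rule \<omega> H S)"
  let ?coincide = "rules_coincide H S (midpoint_rule \<omega> H S) (outer_rule \<omega> S)"
  let ?cone = "\<forall>x\<in>lifts S. p \<in> tangent_hyperplane S (span {x})"
  have "?cone" if ?contact
    using cone_if_tangent_nondegenerate[OF gen tangent_if_generates[OF that]] by blast
  moreover have "?contact" if ?cone
    using generates_if_cone that by blast
  moreover have "?cone" if co: ?coincide
  proof -
    have "p \<in> tangent_hyperplane S q" if q: "q \<in> nondegenerate_points (midpoint_rule \<omega> H S)" for q
    proof -
      obtain x where x: "q = span {x}" "x \<in> lifts S" "x \<notin> H" "dual_point \<omega> S q \<noteq> q"
        using nondegenerate_point_affine[OF q] by metis
      then have "q \<in> affine_part H S"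
        using span_base[of x "{x}"] by (auto simp: affine_part_def lifts_def)
      then have "outer_rule \<omega> S q Z Z'" if "midpoint_rule \<omega> H S q Z Z'" for Z Z'
        using co that unfolding rules_coincide_def by blast
      then show ?thesis
        using tangent_if_rules_agree[OF x(2,3)] x(1,4) by blast
    qed
    then show ?thesis using cone_if_tangent_nondegenerate[OF gen] by blast
  qed
  moreover have "?coincide" if cone: ?cone
    unfolding rules_coincide_def
  proof (intro ballI allI)
    fix q Z Z' assume q: "q \<in> affine_part H S"
    then have "q \<in> proj_points" using S by (auto simp: affine_part_def table_def)
    then obtain x where x: "q = span {x}" by (elim proj_pointE)
    have "x \<in> lifts S" using q x by (simp add: affine_part_def lifts_def)
    moreover have "x \<notin> H"
      using q unfolding affine_part_def x H by (auto simp: span_singleton scaleR_right)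
    ultimately show "midpoint_rule \<omega> H S q Z Z' \<longleftrightarrow> outer_rule \<omega> S q Z Z'"
      unfolding x using rules_agree_if_tangent cone by blast
  qed
  ultimately show ?thesis
    unfolding generalized_cone_iff by blast
qed

end

theorem theorem5p2:
  fixes \<omega> :: "'a::euclidean_space \<Rightarrow> 'a \<Rightarrow> real"
    and H :: "'a set"
    and S :: "'a set set"
  assumes "symplectic_form \<omega>"
    and "proj_hyperplane H"
    and "table S"
    and "generically_nondegenerate \<omega> H S"
  shows "(generates_contact_transformation \<omega> (midpoint_rule \<omega> H S) \<longleftrightarrow>
            rules_coincide H S (midpoint_rule \<omega> H S) (outer_rule \<omega> S)) \<and>
         (rules_coincide H S (midpoint_rule \<omega> H S) (outer_rule \<omega> S) \<longleftrightarrow>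
            generalized_cone S (contact_point \<omega> H))"
proof -
  interpret symplectic \<omega> by unfold_locales (rule assms(1))
  obtain p where p: "p \<noteq> 0" "H = {w. \<omega> p w = 0}"
    using proj_hyperplaneE[OF assms(2)] by metis
  interpret midpoint_table \<omega> p H S by unfold_locales (use p assms(3) in auto)
  show ?thesis by (rule contact_coincide_cone[OF assms(4)])
qed

end
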